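(* For every contextuality scenario $H$, $$\mathcal{Q}(H)=\bigcap_{n\in\mathbb{N},\,n\geq 1}\mathcal{Q}_n(H).$$
   Context: A contextuality scenario is a hypergraph $H$ with finite nonempty vertex set $V(H)$ and edge set $E(H)\subseteq 2^{V(H)}$ such that $\bigcup_{e\in E(H)}e=V(H)$. For $u,v\in V(H)$ write $u\perp v$ if $u\neq v$ and some edge contains both. $\mathcal{Q}(H)$ is the set of quantum models: maps $p:V(H)\to[0,1]$ for which there exist a (complex, possibly infinite-dimensional) Hilbert space $\mathcal{H}$, a positive semidefinite trace-class operator $\rho$ on $\mathcal{H}$ with $\mathrm{tr}\,\rho=1$, and orthogonal projections $P_v$ on $\mathcal{H}$ ($v\in V(H)$) such that $\sum_{v\in e}P_v=\mathbbm{1}_{\mathcal{H}}$ for all $e\in E(H)$ and $p(v)=\mathrm{tr}(\rho P_v)$ for all $v\in V(H)$. For $n\geq1$ let $V(H)^{*n}=\bigcup_{0\leq k\leq n}V(H)^k$ be the set of strings of length at most $n$ over $V(H)$, including the empty string $\emptyset$; $\mathbf{v}x$ denotes the string $\mathbf{v}$ with the letter $x$ appended. $\mathcal{Q}_n(H)$ is the set of maps $p:V(H)\to[0,1]$ for which there is a positive semidefinite complex matrix $M$ with entries $M_{\mathbf{v},\mathbf{w}}$ indexed by $\mathbf{v},\mathbf{w}\in V(H)^{*n}$ such that: $M_{\emptyset,\emptyset}=1$; for all $e\in E(H)$, all $\mathbf{v}$ of length at most $n-1$ and all $\mathbf{w}\in V(H)^{*n}$, $\sum_{x\in e}M_{\mathbf{v}x,\mathbf{w}}=M_{\mathbf{v},\mathbf{w}}$;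 if $\mathbf{v}=v_1\ldots v_k$ and $\mathbf{w}=w_1\ldots w_m$ are nonempty strings with $v_k\perp w_m$, then $M_{\mathbf{v},\mathbf{w}}=0$; and $p(v)=M_{v,\emptyset}$ for all $v\in V(H)$. *)

theory Defs
  imports
    "HOL-Analysis.Analysis"
    "HOL-Algebra.Module"
begin

section \<open>Complex Hilbert spaces\<close>

definition complex_ring :: "complex ring" where
  "complex_ring =
    \<lparr>carrier = UNIV, monoid.mult = (*), one = 1, ring.zero = 0, add = (+)\<rparr>"

text \<open>
  Hilbert spaces are carrier-based structures, so that one can quantify existentially over all
  Hilbert spaces whose points are elements of a given type \<open>'h\<close>. The fields for multiplication
  and unit that modules inherit from rings play no role.
\<close>

record 'h inner_space = "(complex, 'h) module" +
  ip :: "'h \<Rightarrow> 'h \<Rightarrow> complex"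

definition ip_norm :: "('h, 'm) inner_space_scheme \<Rightarrow> 'h \<Rightarrow> real" where
  "ip_norm H x = sqrt (Re (ip H x x))"

text \<open>The inner product is linear in its second argument.\<close>

locale complex_hilbert_space = module complex_ring H for H (structure) +
  assumes ip_add_right: "\<lbrakk>x \<in> carrier H; y \<in> carrier H; z \<in> carrier H\<rbrakk> \<Longrightarrow>
      ip H x (y \<oplus> z) = ip H x y + ip H x z"
    and ip_smult_right: "\<lbrakk>x \<in> carrier H; y \<in> carrier H\<rbrakk> \<Longrightarrow>
      ip H x (c \<odot>\<^bsub>H\<^esub> y) = c * ip H x y"
    and ip_cnj: "\<lbrakk>x \<in> carrier H; y \<in> carrier H\<rbrakk> \<Longrightarrow> ip H y x = cnj (ip H x y)"
    and ip_nonneg: "x \<in> carrier H \<Longrightarrow> ip H x x \<in> \<real>\<^sub>\<ge>\<^sub>0"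
    and ip_definite: "\<lbrakk>x \<in> carrier H; ip H x x = 0\<rbrakk> \<Longrightarrow> x = \<zero>"
    and complete: "\<lbrakk>\<And>n. f n \<in> carrier H;
        \<And>e. e > 0 \<Longrightarrow> \<exists>N. \<forall>m\<ge>N. \<forall>n\<ge>N. ip_norm H (f m \<ominus> f n) < e\<rbrakk> \<Longrightarrow>
      \<exists>x\<in>carrier H. (\<lambda>n. ip_norm H (f n \<ominus> x)) \<longlonglongrightarrow> 0"

definition orthonormal_in :: "('h, 'm) inner_space_scheme \<Rightarrow> 'h set \<Rightarrow> bool" where
  "orthonormal_in H B \<longleftrightarrow> B \<subseteq> carrier H \<and>
     (\<forall>b\<in>B. \<forall>b'\<in>B. ip H b b' = (if b = b' then 1 else 0))"

text \<open>An orthonormal basis is a maximal orthonormal set.\<close>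

definition orthonormal_basis :: "('h, 'm) inner_space_scheme \<Rightarrow> 'h set \<Rightarrow> bool" where
  "orthonormal_basis H B \<longleftrightarrow> orthonormal_in H B \<and>
     (\<forall>B'. orthonormal_in H B' \<and> B \<subseteq> B' \<longrightarrow> B' = B)"


section \<open>Operators\<close>

text \<open>Only the values of an operator on the carrier matter.\<close>

definition bounded_operator :: "('h, 'm) inner_space_scheme \<Rightarrow> ('h \<Rightarrow> 'h) \<Rightarrow> bool" where
  "bounded_operator H A \<longleftrightarrow>
     A \<in> carrier H \<rightarrow> carrier H \<and>
     (\<forall>x\<in>carrier H. \<forall>y\<in>carrier H. A (x \<oplus>\<^bsub>H\<^esub> y) = A x \<oplus>\<^bsub>H\<^esub> A y) \<and>
     (\<forall>c. \<forall>x\<in>carrier H. A (c \<odot>\<^bsub>H\<^esub> x) = c \<odot>\<^bsub>H\<^esub> A x) \<and>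
     (\<exists>K. \<forall>x\<in>carrier H. ip_norm H (A x) \<le> K * ip_norm H x)"

definition positive_operator :: "('h, 'm) inner_space_scheme \<Rightarrow> ('h \<Rightarrow> 'h) \<Rightarrow> bool" where
  "positive_operator H A \<longleftrightarrow> bounded_operator H A \<and>
     (\<forall>x\<in>carrier H. ip H x (A x) \<in> \<real>\<^sub>\<ge>\<^sub>0)"

definition orthogonal_projection :: "('h, 'm) inner_space_scheme \<Rightarrow> ('h \<Rightarrow> 'h) \<Rightarrow> bool" where
  "orthogonal_projection H P \<longleftrightarrow> bounded_operator H P \<and>
     (\<forall>x\<in>carrier H. P (P x) = P x) \<and>
     (\<forall>x\<in>carrier H. \<forall>y\<in>carrier H. ip H (P x) y = ip H x (P y))"

text \<open>
  The operator \<open>T\<close> below is the absolute value \<open>|A|\<close>: it is the unique positive operator with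
  \<open>T\<^sup>2 = A\<^sup>* A\<close>. Summability of \<open>\<langle>b, |A| b\<rangle>\<close> does not depend on the choice of the basis.
\<close>

definition trace_class :: "('h, 'm) inner_space_scheme \<Rightarrow> ('h \<Rightarrow> 'h) \<Rightarrow> bool" where
  "trace_class H A \<longleftrightarrow> bounded_operator H A \<and>
     (\<exists>T. positive_operator H T \<and>
        (\<forall>x\<in>carrier H. \<forall>y\<in>carrier H. ip H (T x) (T y) = ip H (A x) (A y)) \<and>
        (\<exists>B. orthonormal_basis H B \<and> (\<lambda>b. ip H b (T b)) summable_on B))"

text \<open>
  Every Hilbert space has an orthonormal basis, and for a trace-class operator the sum converges
  and has the same value for all of them. The trace is only meaningful for trace-class operators.
\<close>

definition op_trace :: "('h, 'm) inner_space_scheme \<Rightarrow> ('h \<Rightarrow> 'h) \<Rightarrow> complex" where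
  "op_trace H A = (\<Sum>\<^sub>\<infinity>b\<in>(SOME B. orthonormal_basis H B). ip H b (A b))"

definition density_operator :: "('h, 'm) inner_space_scheme \<Rightarrow> ('h \<Rightarrow> 'h) \<Rightarrow> bool" where
  "density_operator H \<rho> \<longleftrightarrow>
     positive_operator H \<rho> \<and> trace_class H \<rho> \<and> op_trace H \<rho> = 1"


section \<open>Contextuality scenarios and quantum models\<close>

text \<open>A hypergraph is given by its vertex set \<open>V\<close> and its edge set \<open>E\<close>.\<close>

definition contextuality_scenario :: "'v set \<Rightarrow> 'v set set \<Rightarrow> bool" where
  "contextuality_scenario V E \<longleftrightarrow> finite V \<and> V \<noteq> {} \<and> E \<subseteq> Pow V \<and> \<Union>E = V"

definition orth :: "'v set set \<Rightarrow> 'v \<Rightarrow> 'v \<Rightarrow> bool" where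
  "orth E u v \<longleftrightarrow> u \<noteq> v \<and> (\<exists>e\<in>E. u \<in> e \<and> v \<in> e)"

text \<open>
  The maps \<open>V \<rightarrow> [0,1]\<close> are extensional functions. The Hilbert space ranges over all complex
  Hilbert spaces whose carrier is a subset of the type \<open>'h\<close>. HOL cannot quantify over types inside
  a formula, so the universe \<open>'h\<close> is a parameter; every separable Hilbert space has an isomorphic
  copy with carrier in \<open>nat \<Rightarrow> complex\<close>, for instance one given by square-summable sequences.
\<close>

definition quantum_models ::
    "'h itself \<Rightarrow> 'v set \<Rightarrow> 'v set set \<Rightarrow> ('v \<Rightarrow> real) set" where
  "quantum_models _ V E = {p \<in> V \<rightarrow>\<^sub>E {0..1}.
     \<exists>(H :: 'h inner_space) \<rho> P.
       complex_hilbert_space H \<and>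
       density_operator H \<rho> \<and>
       (\<forall>v\<in>V. orthogonal_projection H (P v)) \<and>
       (\<forall>e\<in>E. \<forall>x\<in>carrier H. (\<Oplus>\<^bsub>H\<^esub>v\<in>e. P v x) = x) \<and>
       (\<forall>v\<in>V. complex_of_real (p v) = op_trace H (\<rho> \<circ> P v))}"


section \<open>The hierarchy\<close>

definition strings :: "'v set \<Rightarrow> nat \<Rightarrow> 'v list set" where
  "strings V n = {w \<in> lists V. length w \<le> n}"

text \<open>
  For complex matrices, the condition on the quadratic form entails that the matrix is Hermitian.
\<close>

definition psd_matrix_on :: "'i set \<Rightarrow> ('i \<Rightarrow> 'i \<Rightarrow> complex) \<Rightarrow> bool" where
  "psd_matrix_on I M \<longleftrightarrow>
     (\<forall>c :: 'i \<Rightarrow> complex. (\<Sum>i\<in>I. \<Sum>j\<in>I. cnj (c i) * M i j * c j) \<in> \<real>\<^sub>\<ge>\<^sub>0)"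

definition quantum_level :: "nat \<Rightarrow> 'v set \<Rightarrow> 'v set set \<Rightarrow> ('v \<Rightarrow> real) set" where
  "quantum_level n V E = {p \<in> V \<rightarrow>\<^sub>E {0..1}.
     \<exists>M :: 'v list \<Rightarrow> 'v list \<Rightarrow> complex.
       psd_matrix_on (strings V n) M \<and>
       M [] [] = 1 \<and>
       (\<forall>e\<in>E. \<forall>v\<in>strings V (n - 1). \<forall>w\<in>strings V n.
          (\<Sum>x\<in>e. M (v @ [x]) w) = M v w) \<and>
       (\<forall>v\<in>strings V n. \<forall>w\<in>strings V n.
          v \<noteq> [] \<and> w \<noteq> [] \<and> orth E (last v) (last w) \<longrightarrow> M v w = 0) \<and>
       (\<forall>v\<in>V. complex_of_real (p v) = M [v] [])}"

end

theory Submission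
  imports Defs "HOL-Complex_Analysis.Great_Picard"
begin

text \<open>
  Given a quantum model, write \<open>\<rho> = \<Sum>\<^sub>k |u\<^sub>k\<rangle>\<langle>u\<^sub>k|\<close> with \<open>\<Sum>\<^sub>k \<parallel>u\<^sub>k\<parallel>\<^sup>2 = 1\<close>; then
  \<open>M v w = \<Sum>\<^sub>k \<langle>P\<^sub>v u\<^sub>k, P\<^sub>w u\<^sub>k\<rangle>\<close>, where \<open>P\<^sub>v\<close> applies the projections of the letters of \<open>v\<close>
  from left to right, is a certificate at every level.

  Conversely, the entries of a certificate are bounded by 1, so a diagonal argument yields a
  certificate on all strings. It is the Gram matrix of vectors \<open>\<xi>\<^sub>w\<close> that are total in a separable
  Hilbert space. Let \<open>P\<^sub>v\<close> project onto the closed span of the \<open>\<xi>\<^sub>w\<^sub>v\<close>. Orthogonality gives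
  \<open>P\<^sub>v \<xi>\<^sub>w = \<xi>\<^sub>w\<^sub>v\<close>, whence \<open>\<Sum>\<^sub>v\<^sub>\<in>\<^sub>e P\<^sub>v = 1\<close> by totality, and \<open>\<xi>\<^sub>\<emptyset>\<close> is the state.

  Both the decomposition of \<open>\<rho>\<close> and the vectors \<open>\<xi>\<^sub>w\<close> come from the Cholesky decomposition of a
  positive semidefinite kernel along a sequence of points.
\<close>

section \<open>Positive semidefinite kernels and their Cholesky decomposition\<close>

text \<open>Two classical tools are bypassed: a spectral theorem or square root for \<rho>, and the
  quotient and completion that turn a Gram matrix into vectors of a Hilbert space. Elimination
  serves for both because its sums are finite as soon as one argument of the kernel is a point of
  the chosen sequence, so no convergence has to be proved at that stage. The trace is a series over
  one orthonormal basis, whereas the certificate is a series over the index of the vectors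
  \<open>u\<^sub>k\<close>. The bridge is an exchange of summation; it is legitimate because trace 1
  makes the squared coefficients of all \<open>u\<^sub>k\<close> in that basis a summable double
  family. A quantum model only asks that the projections of an edge sum to the identity. The zero
  rule of the hierarchy comes from the orthogonality that this forces; in the converse direction the
  zero rule is what makes the constructed projections fit together.\<close>

definition psd_kernel :: "'a set \<Rightarrow> ('a \<Rightarrow> 'a \<Rightarrow> complex) \<Rightarrow> bool" where
  "psd_kernel X K \<longleftrightarrow> (\<forall>F. finite F \<and> F \<subseteq> X \<longrightarrow> psd_matrix_on F K)"

lemma psd_matrix_on_subset:
  assumes "psd_matrix_on I M" "finite I" "J \<subseteq> I"
  shows "psd_matrix_on J M"
  unfolding psd_matrix_on_def
proof
  fix c :: "'a \<Rightarrow> complex"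
  define d where "d = (\<lambda>i. if i \<in> J then c i else 0)"
  have "(\<Sum>i\<in>I. \<Sum>j\<in>I. cnj (d i) * M i j * d j) = (\<Sum>i\<in>J. \<Sum>j\<in>I. cnj (d i) * M i j * d j)"
    by (rule sum.mono_neutral_right) (use assms in \<open>auto simp: d_def\<close>)
  also have "\<dots> = (\<Sum>i\<in>J. \<Sum>j\<in>J. cnj (d i) * M i j * d j)"
    by (intro sum.cong refl sum.mono_neutral_right) (use assms in \<open>auto simp: d_def\<close>)
  also have "\<dots> = (\<Sum>i\<in>J. \<Sum>j\<in>J. cnj (c i) * M i j * c j)"
    by (intro sum.cong refl) (auto simp: d_def)
  finally have "(\<Sum>i\<in>I. \<Sum>j\<in>I. cnj (d i) * M i j * d j) =
    (\<Sum>i\<in>J. \<Sum>j\<in>J. cnj (c i) * M i j * c j)" .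
  moreover have "(\<Sum>i\<in>I. \<Sum>j\<in>I. cnj (d i) * M i j * d j) \<in> \<real>\<^sub>\<ge>\<^sub>0"
    using assms(1) unfolding psd_matrix_on_def by (rule spec)
  ultimately show "(\<Sum>i\<in>J. \<Sum>j\<in>J. cnj (c i) * M i j * c j) \<in> \<real>\<^sub>\<ge>\<^sub>0"
    by simp
qed

lemma psd_kernel_finite: "finite I \<Longrightarrow> psd_matrix_on I M \<Longrightarrow> psd_kernel I M"
  unfolding psd_kernel_def using psd_matrix_on_subset by blast

lemma psd_kernelD:
  assumes "psd_kernel X K" "finite F" "F \<subseteq> X"
  shows "(\<Sum>i\<in>F. \<Sum>j\<in>F. cnj (c i) * K i j * c j) \<in> \<real>\<^sub>\<ge>\<^sub>0"
  using assms unfolding psd_kernel_def psd_matrix_on_def by blast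

section \<open>Consequences of positivity: symmetry, Cauchy-Schwarz, Schur complements\<close>

context
  fixes X :: "'a set" and K :: "'a \<Rightarrow> 'a \<Rightarrow> complex"
  assumes psd: "psd_kernel X K"
begin

lemma psd_kernel_diag: "x \<in> X \<Longrightarrow> K x x \<in> \<real>\<^sub>\<ge>\<^sub>0"
  using psd_kernelD[OF psd, of "{x}" "\<lambda>_. 1"] by simp

text \<open>Equal points are included, where the form collapses to the single coefficient
  \<open>a + b\<close>; this spares the lemmas below a case distinction.\<close>

lemma psd_kernel_two_points:
  assumes "x \<in> X" "y \<in> X"
  shows "cnj a * K x x * a + cnj a * K x y * b + cnj b * K y x * a + cnj b * K y y * b \<in> \<real>\<^sub>\<ge>\<^sub>0"
proof (cases "x = y")
  case True
  have "cnj (a + b) * K x x * (a + b) \<in> \<real>\<^sub>\<ge>\<^sub>0"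
    using psd_kernelD[OF psd, of "{x}" "\<lambda>_. a + b"] assms by simp
  then show ?thesis using True by (simp add: algebra_simps)
next
  case False
  then show ?thesis
    using psd_kernelD[OF psd, of "{x, y}" "\<lambda>i. if i = x then a else b"] assms
    by (simp add: add.assoc)
qed

text \<open>Polarisation: that the form is real at the coefficients 1, 1 relates the imaginary
  parts, and at 1, \<open>\<i>\<close> the real parts.\<close>

lemma psd_kernel_hermitian:
  assumes "x \<in> X" "y \<in> X"
  shows "K y x = cnj (K x y)"
  using psd_kernel_two_points[OF assms, of 1 1] psd_kernel_two_points[OF assms, of 1 \<i>]
    psd_kernel_diag[OF assms(1)] psd_kernel_diag[OF assms(2)]
  by (auto simp: complex_nonneg_Reals_iff complex_eq_iff)

lemma psd_kernel_Cauchy_Schwarz: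
  assumes "x \<in> X" "y \<in> X"
  shows "(cmod (K x y))\<^sup>2 \<le> Re (K x x) * Re (K y y)"
proof -
  have diag: "K x x = of_real (Re (K x x))" "K y y = of_real (Re (K y y))"
    using psd_kernel_diag[OF assms(1)] psd_kernel_diag[OF assms(2)]
    by (auto simp: complex_nonneg_Reals_iff complex_eq_iff)
  have nn: "Re (K x x) \<ge> 0" "Re (K y y) \<ge> 0"
    using psd_kernel_diag[OF assms(1)] psd_kernel_diag[OF assms(2)]
    by (auto simp: complex_nonneg_Reals_iff)
  have h: "K y x = cnj (K x y)"
    by (rule psd_kernel_hermitian[OF assms])
  have sq: "K x y * cnj (K x y) = of_real ((cmod (K x y))\<^sup>2)"
    by (metis complex_norm_square)
  \<comment> \<open>The form at the coefficients \<open>s\<close> and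
    \<open>- t * cnj (K x y)\<close>: this phase turns both mixed terms into multiples of the
    squared modulus.\<close>
  have key: "0 \<le> s\<^sup>2 * Re (K x x) - 2 * s * t * (cmod (K x y))\<^sup>2 + t\<^sup>2 * (cmod (K x y))\<^sup>2 * Re (K y y)"
    for s t :: real
  proof -
    have "cnj (of_real s) * K x x * of_real s + cnj (of_real s) * K x y * (- of_real t * cnj (K x y))
        + cnj (- of_real t * cnj (K x y)) * K y x * of_real s
        + cnj (- of_real t * cnj (K x y)) * K y y * (- of_real t * cnj (K x y))
      = of_real (s\<^sup>2) * K x x - of_real (2 * s * t) * (K x y * cnj (K x y))
        + of_real (t\<^sup>2) * (K x y * cnj (K x y)) * K y y"
      by (simp add: h algebra_simps power2_eq_square)
    also have "\<dots> = of_real (s\<^sup>2 * Re (K x x) - 2 * s * t * (cmod (K x y))\<^sup>2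
        + t\<^sup>2 * (cmod (K x y))\<^sup>2 * Re (K y y))"
      unfolding sq by (subst diag(1), subst diag(2)) simp
    finally show ?thesis
      using psd_kernel_two_points[OF assms, of "of_real s" "- of_real t * cnj (K x y)"]
      by (simp add: complex_nonneg_Reals_iff del: of_real_mult of_real_power of_real_diff of_real_add)
  qed
  show ?thesis
  proof (cases "Re (K y y) = 0")
    case True
    have "(cmod (K x y))\<^sup>2 = 0"
    proof (rule ccontr)
      define q where "q = (cmod (K x y))\<^sup>2"
      assume "(cmod (K x y))\<^sup>2 \<noteq> 0"
      then have "q > 0" by (simp add: q_def)
      \<comment> \<open>The term quadratic in \<open>t\<close> has vanished with
        \<open>K y y\<close>, and this value of \<open>t\<close> makes the remainder equal to
        -1.\<close>
      have "0 \<le> Re (K x x) - 2 * ((Re (K x x) + 1) / (2 * q)) * q"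
        using key[of 1 "(Re (K x x) + 1) / (2 * q)"] True by (simp add: q_def)
      then show False using \<open>q > 0\<close> by (simp add: field_simps)
    qed
    then show ?thesis using True by simp
  next
    case False
    then have "Re (K y y) > 0" using nn by simp
    moreover have "0 \<le> Re (K y y) * (Re (K x x) * Re (K y y) - (cmod (K x y))\<^sup>2)"
      using key[of "Re (K y y)" 1] by (simp add: algebra_simps power2_eq_square)
    ultimately show ?thesis by (simp add: zero_le_mult_iff)
  qed
qed

lemma psd_kernel_null:
  assumes "x \<in> X" "y \<in> X" "K x x = 0"
  shows "K x y = 0" "K y x = 0"
  using psd_kernel_Cauchy_Schwarz[OF assms(1,2)] psd_kernel_hermitian[OF assms(1,2)] assms(3)
  by auto

text \<open>The Schur complement: completing the square in the coefficient of \<open>e\<close> turns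
  its form into a form of \<open>K\<close>. The set is enlarged by \<open>e\<close> so that this
  coefficient is available.\<close>

lemma psd_kernel_residual:
  assumes e: "e \<in> X"
  shows "psd_kernel X (\<lambda>x y. K x y - K x e * K e y / K e e)"
  unfolding psd_kernel_def
proof (intro allI impI)
  let ?R = "\<lambda>x y. K x y - K x e * K e y / K e e"
  fix F assume F: "finite F \<and> F \<subseteq> X"
  have "psd_matrix_on (insert e F) ?R"
    unfolding psd_matrix_on_def
  proof
    fix c :: "'a \<Rightarrow> complex"
    let ?F = "insert e F"
    have fin: "finite ?F" using F by simp
    show "(\<Sum>i\<in>?F. \<Sum>j\<in>?F. cnj (c i) * ?R i j * c j) \<in> \<real>\<^sub>\<ge>\<^sub>0"
    proof (cases "K e e = 0")
      case True
      then show ?thesis using psd_kernelD[OF psd, of ?F c] F e by simp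
    next
      case False
      \<comment> \<open>Subtracting \<open>t\<close> from the coefficient of \<open>e\<close> makes
        \<open>K\<close> act on \<open>d\<close> as the residual acts on \<open>c\<close>. On the
        conjugated side the shift is harmless because the residual vanishes on the row of
        \<open>e\<close>.\<close>
      define t where "t = (\<Sum>j\<in>?F. K e j * c j) / K e e"
      define d where "d = (\<lambda>i. c i - (if i = e then t else 0))"
      have inner: "(\<Sum>j\<in>?F. K i j * d j) = (\<Sum>j\<in>?F. ?R i j * c j)" for i
      proof -
        have "(\<Sum>j\<in>?F. K i j * d j) = (\<Sum>j\<in>?F. K i j * c j) - (\<Sum>j\<in>?F. if j = e then K i j * t else 0)"
          unfolding sum_subtractf[symmetric] by (intro sum.cong refl) (auto simp: d_def algebra_simps)
        also have "\<dots> = (\<Sum>j\<in>?F. K i j * c j) - K i e * t"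
          using fin by (subst sum.delta) auto
        also have "\<dots> = (\<Sum>j\<in>?F. ?R i j * c j)"
          unfolding t_def by (simp add: left_diff_distrib sum_subtractf sum_divide_distrib sum_distrib_left
              mult.assoc del: sum.insert)
        finally show ?thesis .
      qed
      have zero: "(\<Sum>j\<in>?F. ?R e j * c j) = 0"
        using False by (simp del: sum.insert)
      have "(\<Sum>i\<in>?F. \<Sum>j\<in>?F. cnj (d i) * K i j * d j) = (\<Sum>i\<in>?F. cnj (d i) * (\<Sum>j\<in>?F. K i j * d j))"
        by (simp add: sum_distrib_left mult.assoc del: sum.insert)
      also have "\<dots> = (\<Sum>i\<in>?F. cnj (d i) * (\<Sum>j\<in>?F. ?R i j * c j))"
        by (simp only: inner)
      also have "\<dots> = (\<Sum>i\<in>?F. cnj (c i) * (\<Sum>j\<in>?F. ?R i j * c j))"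
        by (intro sum.cong refl) (use zero in \<open>auto simp: d_def simp del: sum.insert\<close>)
      also have "\<dots> = (\<Sum>i\<in>?F. \<Sum>j\<in>?F. cnj (c i) * ?R i j * c j)"
        by (simp add: sum_distrib_left mult.assoc del: sum.insert)
      finally show ?thesis
        using psd_kernelD[OF psd, of ?F d] F e by auto
    qed
  qed
  then show "psd_matrix_on F ?R"
    by (rule psd_matrix_on_subset) (use F in auto)
qed

end

text \<open>At a zero pivot the division yields 0 and the kernel stays unchanged; this is the right value,
  since the row of a zero pivot vanishes.\<close>

primrec residual :: "('a \<Rightarrow> 'a \<Rightarrow> complex) \<Rightarrow> (nat \<Rightarrow> 'a) \<Rightarrow> nat \<Rightarrow> 'a \<Rightarrow> 'a \<Rightarrow> complex" where
  "residual K e 0 = K"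
| "residual K e (Suc n) = (\<lambda>x y. residual K e n x y -
     residual K e n x (e n) * residual K e n (e n) y / residual K e n (e n) (e n))"

text \<open>Row \<open>n\<close> of the triangular factor, as a function on the whole domain and not
  only on the points of the sequence; on a Hilbert space the rows thereby become linear functionals.
  A zero pivot yields the zero row.\<close>

definition cholesky :: "('a \<Rightarrow> 'a \<Rightarrow> complex) \<Rightarrow> (nat \<Rightarrow> 'a) \<Rightarrow> nat \<Rightarrow> 'a \<Rightarrow> complex" where
  "cholesky K e n x = residual K e n (e n) x / of_real (sqrt (Re (residual K e n (e n) (e n))))"

section \<open>Triangularity and exactness of the factorisation\<close>

context
  fixes X :: "'a set" and K :: "'a \<Rightarrow> 'a \<Rightarrow> complex" and e :: "nat \<Rightarrow> 'a"
  assumes psd: "psd_kernel X K" and e: "\<And>n. e n \<in> X"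
begin

lemma psd_kernel_residual_iterate: "psd_kernel X (residual K e n)"
proof (induction n)
  case (Suc n)
  then show ?case using psd_kernel_residual[OF Suc e[of n]] by simp
qed (simp add: psd)

lemma residual_step:
  assumes "x \<in> X" "y \<in> X"
  shows "residual K e (Suc n) x y =
    residual K e n x y - cnj (cholesky K e n x) * cholesky K e n y"
proof -
  let ?R = "residual K e n"
  have "?R (e n) (e n) \<in> \<real>\<^sub>\<ge>\<^sub>0"
    using psd_kernel_diag[OF psd_kernel_residual_iterate] e by blast
  then obtain r where r: "?R (e n) (e n) = of_real r" "r \<ge> 0"
    by (metis nonneg_Reals_cases)
  have "?R x (e n) = cnj (?R (e n) x)"
    using psd_kernel_hermitian[OF psd_kernel_residual_iterate] e assms by blast
  moreover have "complex_of_real (sqrt r) * complex_of_real (sqrt r) = of_real r"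
    using r(2) by (simp flip: of_real_mult)
  ultimately show ?thesis
    unfolding cholesky_def using r by simp
qed

lemma residual_eq:
  assumes "x \<in> X" "y \<in> X"
  shows "residual K e n x y = K x y - (\<Sum>k<n. cnj (cholesky K e k x) * cholesky K e k y)"
proof (induction n)
  case (Suc n)
  then show ?case using residual_step[OF assms, of n] by (simp del: residual.simps(2))
qed simp

text \<open>Step \<open>j\<close> clears its own diagonal entry. A null diagonal entry of a positive
  kernel forces a null row and column, so later steps leave it at zero.\<close>

lemma residual_pivot:
  assumes "j < n" "y \<in> X"
  shows "residual K e n (e j) y = 0" "residual K e n y (e j) = 0"
proof -
  have "residual K e n (e j) (e j) = 0"
    using assms(1)
  proof (induction n)
    case (Suc n)
    show ?case
    proof (cases "j = n")
      case False
      then have 0: "residual K e n (e j) (e j) = 0" using Suc by simp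
      then have "residual K e n (e j) (e n) = 0"
        using psd_kernel_null[OF psd_kernel_residual_iterate] e by blast
      then show ?thesis using 0 by simp
    qed simp
  qed simp
  then show "residual K e n (e j) y = 0" "residual K e n y (e j) = 0"
    using psd_kernel_null[OF psd_kernel_residual_iterate] e assms(2) by blast+
qed

lemma cholesky_triangular: "j < n \<Longrightarrow> cholesky K e n (e j) = 0"
  unfolding cholesky_def using residual_pivot(2)[of j n "e n", OF _ e] by (metis div_0)

lemma cholesky_pivot_zero:
  assumes "cholesky K e n (e n) = 0" "x \<in> X"
  shows "cholesky K e n x = 0"
proof -
  have "residual K e n (e n) (e n) \<in> \<real>\<^sub>\<ge>\<^sub>0"
    by (rule psd_kernel_diag[OF psd_kernel_residual_iterate e])
  then have "residual K e n (e n) (e n) = 0"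
    using assms(1) by (auto simp: cholesky_def complex_nonneg_Reals_iff complex_eq_iff)
  then have "residual K e n (e n) x = 0"
    by (intro psd_kernel_null(1)[OF psd_kernel_residual_iterate e assms(2)])
  then show ?thesis by (simp add: cholesky_def)
qed

text \<open>Exact after finitely many steps: once pivot \<open>j\<close> has been processed, the
  remainder in \<open>residual_eq\<close> vanishes on its row, whatever \<open>y\<close> is.\<close>

lemma cholesky_decomposition:
  assumes "j < n" "y \<in> X"
  shows "K (e j) y = (\<Sum>k<n. cnj (cholesky K e k (e j)) * cholesky K e k y)"
  using residual_eq[OF e assms(2), where n = n] residual_pivot(1)[OF assms]
  by (metis eq_iff_diff_eq_0)

text \<open>The residual at \<open>x\<close> stays nonnegative, so the squared moduli of the rows at
  \<open>x\<close> sum to at most \<open>K x x\<close>. This also reaches points that the sequence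
  misses.\<close>

lemma cholesky_null:
  assumes x: "x \<in> X" and "K x x = 0"
  shows "cholesky K e n x = 0"
proof -
  have "(\<Sum>k<Suc n. cnj (cholesky K e k x) * cholesky K e k x) = - residual K e (Suc n) x x"
    using residual_eq[OF x x, of "Suc n"] assms(2) by simp
  moreover have "residual K e (Suc n) x x \<in> \<real>\<^sub>\<ge>\<^sub>0"
    by (rule psd_kernel_diag[OF psd_kernel_residual_iterate x])
  ultimately have "Re (\<Sum>k<Suc n. cnj (cholesky K e k x) * cholesky K e k x) \<le> 0"
    by (simp add: complex_nonneg_Reals_iff del: residual.simps sum.lessThan_Suc)
  also have "Re (\<Sum>k<Suc n. cnj (cholesky K e k x) * cholesky K e k x)
      = (\<Sum>k<Suc n. (cmod (cholesky K e k x))\<^sup>2)"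
    unfolding Re_sum by (intro sum.cong refl) (simp add: cmod_power2 flip: power2_eq_square)
  finally have "(\<Sum>k<Suc n. (cmod (cholesky K e k x))\<^sup>2) = 0"
    by (intro antisym sum_nonneg) auto
  then have "(cmod (cholesky K e n x))\<^sup>2 = 0"
    by (subst (asm) sum_nonneg_eq_0_iff) auto
  then show ?thesis by simp
qed

text \<open>The scalar does not depend on \<open>y\<close>: row \<open>n\<close> is a combination of
  \<open>K (e n)\<close> and the earlier rows, which permits representing the rows by vectors
  inductively.\<close>

lemma cholesky_recursion:
  "\<exists>s. \<forall>y\<in>X. cholesky K e n y =
    s * (K (e n) y - (\<Sum>k<n. cnj (cholesky K e k (e n)) * cholesky K e k y))"
proof (intro exI ballI)
  fix y assume "y \<in> X"
  then show "cholesky K e n y = (1 / of_real (sqrt (Re (residual K e n (e n) (e n))))) *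
      (K (e n) y - (\<Sum>k<n. cnj (cholesky K e k (e n)) * cholesky K e k y))"
    unfolding residual_eq[OF e \<open>y \<in> X\<close>, symmetric] by (subst cholesky_def) simp
qed

end

section \<open>Projections and orthonormal expansions in Hilbert spaces\<close>

lemma complex_ring_simps [simp]:
  "carrier complex_ring = UNIV" "add complex_ring = (+)" "mult complex_ring = (*)"
  "one complex_ring = 1" "ring.zero complex_ring = 0"
  by (simp_all add: complex_ring_def)

lemma ip_norm_squared: "ip H x x \<in> \<real>\<^sub>\<ge>\<^sub>0 \<Longrightarrow> (ip_norm H x)\<^sup>2 = Re (ip H x x)"
  by (simp add: ip_norm_def complex_nonneg_Reals_iff)

section \<open>Algebra of the inner product\<close>

context complex_hilbert_space
begin

lemma scale_closed [simp]: "x \<in> carrier H \<Longrightarrow> c \<odot> x \<in> carrier H"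
  using smult_closed[of c x] by simp

lemma ip_zero_right [simp]: "x \<in> carrier H \<Longrightarrow> ip H x \<zero> = 0"
  using ip_add_right[of x \<zero> \<zero>] by simp

lemma ip_zero_left [simp]: "x \<in> carrier H \<Longrightarrow> ip H \<zero> x = 0"
  using ip_cnj[of x \<zero>] by simp

lemma ip_add_left:
  assumes "x \<in> carrier H" "y \<in> carrier H" "z \<in> carrier H"
  shows "ip H (x \<oplus> y) z = ip H x z + ip H y z"
  using assms ip_add_right[of z x y] ip_cnj[of z "x \<oplus> y"] ip_cnj[of z x] ip_cnj[of z y] by simp

lemma ip_smult_left:
  assumes "x \<in> carrier H" "y \<in> carrier H"
  shows "ip H (c \<odot> x) y = cnj c * ip H x y"
  using assms ip_smult_right[of y x c] ip_cnj[of y "c \<odot> x"] ip_cnj[of y x] by simp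

lemma ip_minus_right:
  assumes "x \<in> carrier H" "y \<in> carrier H"
  shows "ip H x (\<ominus> y) = - ip H x y"
  using assms ip_add_right[of x y "\<ominus> y"] by (simp add: M.r_neg eq_neg_iff_add_eq_0 add.commute)

lemma ip_diff_right:
  assumes "x \<in> carrier H" "y \<in> carrier H" "z \<in> carrier H"
  shows "ip H x (y \<ominus> z) = ip H x y - ip H x z"
  using assms by (simp add: M.minus_eq ip_add_right ip_minus_right)

lemma ip_diff_left:
  assumes "x \<in> carrier H" "y \<in> carrier H" "z \<in> carrier H"
  shows "ip H (x \<ominus> y) z = ip H x z - ip H y z"
  using assms ip_diff_right[of z x y] ip_cnj[of z "x \<ominus> y"] ip_cnj[of z x] ip_cnj[of z y] by simp

lemma ip_finsum_right:
  assumes "finite F" "x \<in> carrier H" "f \<in> F \<rightarrow> carrier H"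
  shows "ip H x (\<Oplus>i\<in>F. f i) = (\<Sum>i\<in>F. ip H x (f i))"
  using assms(1,3)
  by (induction F) (simp_all add: assms(2) ip_add_right Pi_def M.finsum_insert M.finsum_closed)

lemma ip_finsum_left:
  assumes "finite F" "x \<in> carrier H" "f \<in> F \<rightarrow> carrier H"
  shows "ip H (\<Oplus>i\<in>F. f i) x = (\<Sum>i\<in>F. ip H (f i) x)"
  using assms(1,3)
  by (induction F) (simp_all add: assms(2) ip_add_left Pi_def M.finsum_insert M.finsum_closed)

lemma eq_if_diff_zero:
  assumes "x \<in> carrier H" "y \<in> carrier H" "x \<ominus> y = \<zero>"
  shows "x = y"
proof -
  have "x = (x \<ominus> y) \<oplus> y"
    using assms(1,2) by (simp add: M.minus_eq M.a_assoc M.l_neg)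
  then show ?thesis using assms by simp
qed

lemma eq_if_ip_eq:
  assumes "x \<in> carrier H" "y \<in> carrier H" "\<And>z. z \<in> carrier H \<Longrightarrow> ip H z x = ip H z y"
  shows "x = y"
proof (rule eq_if_diff_zero[OF assms(1,2)])
  show "x \<ominus> y = \<zero>"
    by (rule ip_definite) (use assms in \<open>simp_all add: ip_diff_right\<close>)
qed

section \<open>Bounded and positive operators, Cauchy-Schwarz\<close>

lemma bounded_operator_closed: "bounded_operator H A \<Longrightarrow> x \<in> carrier H \<Longrightarrow> A x \<in> carrier H"
  unfolding bounded_operator_def by blast

lemma bounded_operator_zero:
  assumes "bounded_operator H A"
  shows "A \<zero> = \<zero>"
proof -
  have "A (0 \<odot> \<zero>) = 0 \<odot> A \<zero>"
    using assms unfolding bounded_operator_def by blast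
  then show ?thesis
    using smult_l_null[of "A \<zero>"] smult_l_null[of \<zero>] bounded_operator_closed[OF assms] by simp
qed

lemma bounded_operator_finsum:
  assumes A: "bounded_operator H A" and "finite F" "f \<in> F \<rightarrow> carrier H"
  shows "A (\<Oplus>i\<in>F. f i) = (\<Oplus>i\<in>F. A (f i))"
  using assms(2,3)
proof (induction F)
  case empty
  then show ?case by (simp add: bounded_operator_zero[OF A])
next
  case (insert i F)
  then have f: "f i \<in> carrier H" "f \<in> F \<rightarrow> carrier H" by auto
  then have "(\<Oplus>i\<in>F. f i) \<in> carrier H" by (rule_tac M.finsum_closed)
  then have "A (f i \<oplus> (\<Oplus>i\<in>F. f i)) = A (f i) \<oplus> A (\<Oplus>i\<in>F. f i)"
    using A f(1) unfolding bounded_operator_def by blast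
  moreover have "(\<lambda>i. A (f i)) \<in> F \<rightarrow> carrier H" "A (f i) \<in> carrier H"
    using f bounded_operator_closed[OF A] by auto
  ultimately show ?case
    using insert f by (simp add: M.finsum_insert)
qed

text \<open>The double sum is \<open>ip H s (A s)\<close> for the linear combination
  \<open>s\<close>. An indexed family allows repeated vectors; for the identity this is positivity
  of Gram matrices.\<close>

lemma positive_operator_gram:
  assumes "positive_operator H A" and F: "finite F" and x: "\<And>i. i \<in> F \<Longrightarrow> x i \<in> carrier H"
  shows "(\<Sum>i\<in>F. \<Sum>j\<in>F. cnj (c i) * ip H (x i) (A (x j)) * c j) \<in> \<real>\<^sub>\<ge>\<^sub>0"
proof -
  have A: "bounded_operator H A" using assms(1) unfolding positive_operator_def by blast
  define s where "s = (\<Oplus>i\<in>F. c i \<odot> x i)"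
  have f: "(\<lambda>i. c i \<odot> x i) \<in> F \<rightarrow> carrier H" using x by auto
  have "A (c i \<odot> x i) = c i \<odot> A (x i)" if "i \<in> F" for i
    using A x[OF that] unfolding bounded_operator_def by blast
  then have Af: "(\<lambda>i. A (c i \<odot> x i)) \<in> F \<rightarrow> carrier H"
    "\<And>i. i \<in> F \<Longrightarrow> A (c i \<odot> x i) = c i \<odot> A (x i)"
    using x bounded_operator_closed[OF A] by auto
  have s: "s \<in> carrier H" unfolding s_def by (rule M.finsum_closed[OF f])
  have "ip H s (A s) = (\<Sum>j\<in>F. ip H s (A (c j \<odot> x j)))"
    using ip_finsum_right[OF F s Af(1)] bounded_operator_finsum[OF A F f] by (simp add: s_def)
  also have "\<dots> = (\<Sum>j\<in>F. ip H s (A (x j)) * c j)"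
    using s x bounded_operator_closed[OF A] Af(2)
    by (intro sum.cong refl) (auto simp: ip_smult_right)
  also have "\<dots> = (\<Sum>j\<in>F. (\<Sum>i\<in>F. cnj (c i) * ip H (x i) (A (x j))) * c j)"
  proof (rule sum.cong[OF refl])
    fix j assume j: "j \<in> F"
    then have Aj: "A (x j) \<in> carrier H" using x bounded_operator_closed[OF A] by blast
    have "ip H s (A (x j)) = (\<Sum>i\<in>F. ip H (c i \<odot> x i) (A (x j)))"
      unfolding s_def by (rule ip_finsum_left[OF F Aj f])
    also have "\<dots> = (\<Sum>i\<in>F. cnj (c i) * ip H (x i) (A (x j)))"
      using x Aj by (intro sum.cong refl ip_smult_left) auto
    finally show "ip H s (A (x j)) * c j = (\<Sum>i\<in>F. cnj (c i) * ip H (x i) (A (x j))) * c j" by simp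
  qed
  also have "\<dots> = (\<Sum>i\<in>F. \<Sum>j\<in>F. cnj (c i) * ip H (x i) (A (x j)) * c j)"
    unfolding sum_distrib_right by (rule sum.swap)
  finally show ?thesis
    using assms(1) s unfolding positive_operator_def by (metis (no_types, lifting))
qed

lemma psd_kernel_positive_operator:
  assumes "positive_operator H A"
  shows "psd_kernel (carrier H) (\<lambda>x y. ip H x (A y))"
  unfolding psd_kernel_def psd_matrix_on_def
  by (intro allI impI positive_operator_gram[OF assms, where x = "\<lambda>x. x"]) auto

lemma bounded_operator_id: "bounded_operator H (\<lambda>x. x)"
  unfolding bounded_operator_def by (auto intro!: exI[of _ 1])

lemma positive_operator_id: "positive_operator H (\<lambda>x. x)"
  using ip_nonneg by (simp add: positive_operator_def bounded_operator_id)

lemma psd_kernel_ip: "psd_kernel (carrier H) (ip H)"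
  by (rule psd_kernel_positive_operator[OF positive_operator_id])

lemma ip_norm_nonneg: "x \<in> carrier H \<Longrightarrow> 0 \<le> ip_norm H x"
  using ip_nonneg by (simp add: ip_norm_def complex_nonneg_Reals_iff)

lemma norm_square: "x \<in> carrier H \<Longrightarrow> ip H x x = of_real ((ip_norm H x)\<^sup>2)"
  using ip_nonneg by (simp add: ip_norm_squared complex_nonneg_Reals_iff complex_eq_iff
      del: of_real_power)

lemma Cauchy_Schwarz:
  assumes "x \<in> carrier H" "y \<in> carrier H"
  shows "cmod (ip H x y) \<le> ip_norm H x * ip_norm H y"
proof (rule power2_le_imp_le)
  show "(cmod (ip H x y))\<^sup>2 \<le> (ip_norm H x * ip_norm H y)\<^sup>2"
    using psd_kernel_Cauchy_Schwarz[OF psd_kernel_ip assms] assms ip_nonneg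
    by (simp add: power_mult_distrib ip_norm_squared)
qed (use assms ip_norm_nonneg in auto)

text \<open>Meant for \<open>y = P x\<close> with \<open>P\<close> self-adjoint and idempotent,
  where it says that \<open>P\<close> is a contraction.\<close>

lemma norm_le_if_ip_eq:
  assumes y: "y \<in> carrier H" and x: "x \<in> carrier H" and eq: "ip H y y = ip H x y"
  shows "ip_norm H y \<le> ip_norm H x"
proof -
  have "(ip_norm H y)\<^sup>2 = Re (ip H x y)"
    using ip_nonneg[OF y] by (simp add: ip_norm_squared eq)
  also have "\<dots> \<le> ip_norm H x * ip_norm H y"
    by (rule order_trans[OF complex_Re_le_cmod Cauchy_Schwarz[OF x y]])
  finally have "ip_norm H y * ip_norm H y \<le> ip_norm H x * ip_norm H y"
    by (simp add: power2_eq_square)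
  then show ?thesis
    using ip_norm_nonneg[OF x] ip_norm_nonneg[OF y] by (cases "ip_norm H y = 0") simp_all
qed

section \<open>Orthonormal expansions and Bessel's inequality\<close>

context
  fixes B :: "'a set"
  assumes B: "orthonormal_in H B"
begin

private definition partial_expansion :: "'a \<Rightarrow> 'a set \<Rightarrow> 'a" where
  "partial_expansion x F = (\<Oplus>b\<in>F. ip H b x \<odot> b)"

private lemma in_carrier: "b \<in> B \<Longrightarrow> b \<in> carrier H"
  using B unfolding orthonormal_in_def by blast

private lemma partial_closed:
  assumes "F \<subseteq> B"
  shows "partial_expansion x F \<in> carrier H"
  unfolding partial_expansion_def using assms in_carrier by (intro M.finsum_closed) auto

private lemma ip_partial:
  assumes "finite F" "F \<subseteq> B" "z \<in> carrier H"
  shows "ip H z (partial_expansion x F) = (\<Sum>b\<in>F. ip H z b * ip H b x)"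
proof -
  have "ip H z (partial_expansion x F) = (\<Sum>b\<in>F. ip H z (ip H b x \<odot> b))"
    unfolding partial_expansion_def using assms in_carrier by (intro ip_finsum_right) auto
  also have "\<dots> = (\<Sum>b\<in>F. ip H z b * ip H b x)"
    using assms in_carrier by (intro sum.cong refl) (auto simp: ip_smult_right subset_iff)
  finally show ?thesis .
qed

private lemma ip_basis_partial:
  assumes "finite F" "F \<subseteq> B" "b \<in> B"
  shows "ip H b (partial_expansion x F) = (if b \<in> F then ip H b x else 0)"
proof -
  have "ip H b (partial_expansion x F) = (\<Sum>b'\<in>F. if b' = b then ip H b x else 0)"
    unfolding ip_partial[OF assms(1,2) in_carrier[OF assms(3)]]
    using B assms by (intro sum.cong refl) (auto simp: orthonormal_in_def subset_iff)
  then show ?thesis using assms(1) by simp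
qed

private lemma ip_partial_partial:
  assumes "finite F" "F \<subseteq> B" "finite G" "G \<subseteq> B" "x \<in> carrier H"
  shows "ip H (partial_expansion x F) (partial_expansion x G) =
    of_real (\<Sum>b\<in>F \<inter> G. (cmod (ip H b x))\<^sup>2)"
proof -
  have "ip H (partial_expansion x F) (partial_expansion x G) =
      (\<Sum>b\<in>G. ip H (partial_expansion x F) b * ip H b x)"
    by (rule ip_partial[OF assms(3,4) partial_closed[OF assms(2)]])
  also have "\<dots> = (\<Sum>b\<in>G. if b \<in> F then of_real ((cmod (ip H b x))\<^sup>2) else 0)"
  proof (intro sum.cong refl)
    fix b assume "b \<in> G"
    then have b: "b \<in> B" using assms by blast
    have "ip H (partial_expansion x F) b = cnj (if b \<in> F then ip H b x else 0)"
      using ip_cnj[OF in_carrier[OF b] partial_closed[OF assms(2)]] ip_basis_partial[OF assms(1,2) b]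
      by simp
    then show "ip H (partial_expansion x F) b * ip H b x =
        (if b \<in> F then of_real ((cmod (ip H b x))\<^sup>2) else 0)"
      using complex_norm_square[of "ip H b x"] by (simp add: mult.commute)
  qed
  also have "\<dots> = (\<Sum>b\<in>F \<inter> G. of_real ((cmod (ip H b x))\<^sup>2))"
    by (subst Int_commute) (rule sum.inter_restrict[OF assms(3), symmetric])
  finally show ?thesis by simp
qed

private lemma Bessel_finite:
  assumes "finite F" "F \<subseteq> B" "x \<in> carrier H"
  shows "(\<Sum>b\<in>F. (cmod (ip H b x))\<^sup>2) \<le> (ip_norm H x)\<^sup>2"
proof -
  let ?s = "\<Sum>b\<in>F. (cmod (ip H b x))\<^sup>2" and ?p = "partial_expansion x F"
  have p: "?p \<in> carrier H" by (rule partial_closed[OF assms(2)])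
  have pp: "ip H ?p ?p = of_real ?s"
    using ip_partial_partial[OF assms(1,2,1,2,3)] by simp
  have xp: "ip H x ?p = of_real ?s"
  proof -
    have "ip H x ?p = (\<Sum>b\<in>F. ip H x b * ip H b x)"
      by (rule ip_partial[OF assms])
    also have "\<dots> = (\<Sum>b\<in>F. of_real ((cmod (ip H b x))\<^sup>2))"
    proof (intro sum.cong refl)
      fix b assume "b \<in> F"
      then have "ip H x b = cnj (ip H b x)"
        using assms in_carrier by (intro ip_cnj) auto
      then show "ip H x b * ip H b x = of_real ((cmod (ip H b x))\<^sup>2)"
        using complex_norm_square[of "ip H b x"] by (simp add: mult.commute)
    qed
    finally show ?thesis by simp
  qed
  have "ip H (x \<ominus> ?p) (x \<ominus> ?p) = of_real ((ip_norm H x)\<^sup>2 - ?s)"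
    using assms(3) p pp xp ip_cnj[OF assms(3) p] norm_square[OF assms(3)]
    by (simp add: ip_diff_right ip_diff_left)
  moreover have "ip H (x \<ominus> ?p) (x \<ominus> ?p) \<in> \<real>\<^sub>\<ge>\<^sub>0"
    using assms(3) p by (intro ip_nonneg) simp
  ultimately show ?thesis
    by (metis Re_complex_of_real diff_ge_0_iff_ge complex_nonneg_Reals_iff)
qed

private lemma coefficients_summable:
  assumes "x \<in> carrier H"
  shows "(\<lambda>b. (cmod (ip H b x))\<^sup>2) summable_on B"
  by (rule nonneg_bounded_partial_sums_imp_summable_on[where C = "(ip_norm H x)\<^sup>2"])
     (use Bessel_finite[OF _ _ assms] in \<open>auto simp: eventually_finite_subsets_at_top intro!: exI[of _ "{}"]\<close>)

text \<open>The squared distance of two partial sums is the sum of the squared coefficients over the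
  symmetric difference of the index sets. Beyond \<open>G\<close> each of its two halves contributes
  at most a quarter of the squared tolerance.\<close>

private lemma partial_Cauchy:
  assumes x: "x \<in> carrier H" and "\<epsilon> > 0"
  shows "\<exists>G. finite G \<and> G \<subseteq> B \<and> (\<forall>F F'. finite F \<and> G \<subseteq> F \<and> F \<subseteq> B \<and> finite F' \<and> G \<subseteq> F' \<and> F' \<subseteq> B \<longrightarrow>
    ip_norm H (partial_expansion x F \<ominus> partial_expansion x F') < \<epsilon>)"
proof -
  let ?q = "\<lambda>b. (cmod (ip H b x))\<^sup>2"
  obtain S where S: "(?q has_sum S) B"
    using coefficients_summable[OF x] unfolding summable_on_def by blast
  obtain G where G: "finite G" "G \<subseteq> B" "dist (sum ?q G) S \<le> \<epsilon>\<^sup>2 / 4"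
    using has_sum_finite_approximation[OF S, of "\<epsilon>\<^sup>2 / 4"] assms(2) by auto
  have small: "sum ?q (F - F') \<le> \<epsilon>\<^sup>2 / 4"
    if "finite F" "F \<subseteq> B" "G \<subseteq> F'" for F F'
  proof -
    have "sum ?q (F - F') + sum ?q G = sum ?q ((F - F') \<union> G)"
      using that G by (subst sum.union_disjoint) auto
    also have "\<dots> \<le> S"
      using that G by (intro has_sum_mono_neutral[OF has_sum_finite S]) auto
    finally show ?thesis using G(3) unfolding dist_real_def by linarith
  qed
  have close: "ip_norm H (partial_expansion x F \<ominus> partial_expansion x F') < \<epsilon>"
    if F: "finite F" "G \<subseteq> F" "F \<subseteq> B" "finite F'" "G \<subseteq> F'" "F' \<subseteq> B" for F F'
  proof (rule power2_less_imp_less)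
    let ?p = "partial_expansion x F" and ?p' = "partial_expansion x F'"
    have c: "?p \<in> carrier H" "?p' \<in> carrier H"
      using F partial_closed by auto
    have "ip H (?p \<ominus> ?p') (?p \<ominus> ?p') = of_real (sum ?q F + sum ?q F' - 2 * sum ?q (F \<inter> F'))"
      using c F x by (simp add: ip_diff_left ip_diff_right ip_partial_partial Int_commute)
    also have "sum ?q F + sum ?q F' - 2 * sum ?q (F \<inter> F') = sum ?q (F - F') + sum ?q (F' - F)"
      using sum.Int_Diff[OF F(1), of ?q F'] sum.Int_Diff[OF F(4), of ?q F] by (simp add: Int_commute)
    finally have "(ip_norm H (?p \<ominus> ?p'))\<^sup>2 = sum ?q (F - F') + sum ?q (F' - F)"
      using c ip_nonneg[of "?p \<ominus> ?p'"] by (simp add: ip_norm_squared)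
    also have "\<dots> \<le> \<epsilon>\<^sup>2 / 2"
      using small[OF F(1,3,5)] small[OF F(4,6,2)] by simp
    also have "\<dots> < \<epsilon>\<^sup>2" using assms(2) by simp
    finally show "(ip_norm H (?p \<ominus> ?p'))\<^sup>2 < \<epsilon>\<^sup>2" .
  qed (use assms(2) in simp)
  show ?thesis
    by (intro exI[of _ G] conjI allI impI G; elim conjE) (rule close; assumption)
qed

text \<open>Completeness speaks of sequences, while the expansion is a net over the finite subsets
  of a possibly uncountable \<open>B\<close>. The sets \<open>G n\<close> witness the Cauchy
  property of the net at tolerance 1/(n+1); their unions \<open>U n\<close> increase, and the limit
  along them attracts the whole net. Convergence is recorded through inner products with
  \<open>z\<close>, the form in which projections are computed.\<close>

lemma orthonormal_expansion:
  assumes x: "x \<in> carrier H"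
  shows "\<exists>y\<in>carrier H. \<forall>z\<in>carrier H. ((\<lambda>b. ip H z b * ip H b x) has_sum ip H z y) B"
proof -
  let ?p = "partial_expansion x"
  have "\<forall>n. \<exists>G. finite G \<and> G \<subseteq> B \<and> (\<forall>F F'. finite F \<and> G \<subseteq> F \<and> F \<subseteq> B \<and> finite F' \<and> G \<subseteq> F' \<and> F' \<subseteq> B \<longrightarrow>
    ip_norm H (?p F \<ominus> ?p F') < inverse (real (Suc n)))"
    by (intro allI partial_Cauchy[OF x]) simp
  from choice[OF this] obtain G where Gall: "\<forall>n. finite (G n) \<and> G n \<subseteq> B \<and>
      (\<forall>F F'. finite F \<and> G n \<subseteq> F \<and> F \<subseteq> B \<and> finite F' \<and> G n \<subseteq> F' \<and> F' \<subseteq> B \<longrightarrow>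
      ip_norm H (?p F \<ominus> ?p F') < inverse (real (Suc n)))" ..
  then have G: "\<And>n. finite (G n)" "\<And>n. G n \<subseteq> B" by blast+
  have Gsmall: "ip_norm H (?p F \<ominus> ?p F') < inverse (real (Suc n))"
    if "finite F" "G n \<subseteq> F" "F \<subseteq> B" "finite F'" "G n \<subseteq> F'" "F' \<subseteq> B" for n F F'
    using spec[OF Gall, of n] that by blast
  define U where "U n = (\<Union>m\<le>n. G m)" for n
  have U: "finite (U n)" "U n \<subseteq> B" "m \<le> n \<Longrightarrow> G m \<subseteq> U n" for m n
    using G by (auto simp: U_def)
  have pc: "?p (U n) \<in> carrier H" for n by (rule partial_closed[OF U(2)])
  have Cauchy: "\<exists>N. \<forall>m\<ge>N. \<forall>n\<ge>N. ip_norm H (?p (U m) \<ominus> ?p (U n)) < e" if "e > 0" for e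
  proof -
    obtain N where "inverse (real (Suc N)) < e" using reals_Archimedean[OF \<open>e > 0\<close>] by blast
    then show ?thesis
      using Gsmall[OF U(1) U(3) U(2) U(1) U(3) U(2)] by (meson less_trans)
  qed
  obtain y where y: "y \<in> carrier H" and lim: "(\<lambda>n. ip_norm H (?p (U n) \<ominus> y)) \<longlonglongrightarrow> 0"
    using complete[of "\<lambda>n. ?p (U n)", OF pc Cauchy] by blast
  show ?thesis
  proof (intro bexI[OF _ y] ballI)
    fix z assume z: "z \<in> carrier H"
    show "((\<lambda>b. ip H z b * ip H b x) has_sum ip H z y) B"
      unfolding has_sum_def tendsto_iff eventually_finite_subsets_at_top
    proof (intro allI impI)
      fix e :: real assume "e > 0"
      \<comment> \<open>The added 1 keeps the denominator positive and makes the final estimate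
        strict.\<close>
      define \<delta> where "\<delta> = e / (2 * (ip_norm H z + 1))"
      have nz: "ip_norm H z \<ge> 0" by (rule ip_norm_nonneg[OF z])
      have \<delta>: "\<delta> > 0" using \<open>e > 0\<close> nz by (simp add: \<delta>_def)
      have "(\<lambda>n. inverse (real (Suc n))) \<longlonglongrightarrow> 0" by (rule LIMSEQ_inverse_real_of_nat)
      then have "eventually (\<lambda>n. inverse (real (Suc n)) < \<delta> \<and> ip_norm H (?p (U n) \<ominus> y) < \<delta>) sequentially"
        using \<delta> lim by (intro eventually_conj order_tendstoD) auto
      then obtain n where n: "inverse (real (Suc n)) < \<delta>" "ip_norm H (?p (U n) \<ominus> y) < \<delta>"
        by (auto simp: eventually_sequentially)
      have close: "dist (\<Sum>b\<in>F. ip H z b * ip H b x) (ip H z y) < e"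
        if F: "finite F" "U n \<subseteq> F" "F \<subseteq> B" for F
      proof -
        have Fc: "?p F \<in> carrier H" by (rule partial_closed[OF F(3)])
        have 1: "ip_norm H (?p F \<ominus> ?p (U n)) < \<delta>"
          using Gsmall[of F n "U n"] F U n(1) by fastforce
        have "(\<Sum>b\<in>F. ip H z b * ip H b x) - ip H z y =
            ip H z (?p F \<ominus> ?p (U n)) + ip H z (?p (U n) \<ominus> y)"
          using F z y Fc pc by (simp add: ip_diff_right ip_partial)
        also have "cmod \<dots> \<le> ip_norm H z * ip_norm H (?p F \<ominus> ?p (U n)) + ip_norm H z * ip_norm H (?p (U n) \<ominus> y)"
          using z Fc pc y by (intro norm_triangle_mono Cauchy_Schwarz) auto
        also have "\<dots> \<le> ip_norm H z * \<delta> + ip_norm H z * \<delta>"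
          using nz 1 n(2) by (intro add_mono mult_left_mono) auto
        also have "\<dots> < (ip_norm H z + 1) * (2 * \<delta>)"
          using \<delta> by (simp add: algebra_simps)
        also have "\<dots> = e"
          using nz add_nonneg_pos[OF nz zero_less_one] by (simp add: \<delta>_def divide_simps)
        finally show ?thesis by (simp add: dist_norm)
      qed
      show "\<exists>X. finite X \<and> X \<subseteq> B \<and>
          (\<forall>Y. finite Y \<and> X \<subseteq> Y \<and> Y \<subseteq> B \<longrightarrow> dist (\<Sum>b\<in>Y. ip H z b * ip H b x) (ip H z y) < e)"
        by (intro exI[of _ "U n"] conjI allI impI U; elim conjE) (rule close; assumption)
    qed
  qed
qed

end

section \<open>Maximal orthonormal sets and the projections they define\<close>

lemma maximal_orthonormal:
  "\<exists>B. orthonormal_in H B \<and> B \<subseteq> S \<and> (\<forall>B'. orthonormal_in H B' \<and> B' \<subseteq> S \<and> B \<subseteq> B' \<longrightarrow> B' = B)"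
proof -
  let ?A = "{B. orthonormal_in H B \<and> B \<subseteq> S}"
  have "\<exists>M\<in>?A. \<forall>X\<in>?A. M \<subseteq> X \<longrightarrow> X = M"
  proof (rule subset_Zorn')
    fix C assume "subset.chain ?A C"
    then have C: "C \<subseteq> ?A" "\<And>X Y. X \<in> C \<Longrightarrow> Y \<in> C \<Longrightarrow> X \<subseteq> Y \<or> Y \<subseteq> X"
      unfolding subset_chain_def by blast+
    have "ip H b b' = (if b = b' then 1 else 0)" if b: "b \<in> \<Union>C" "b' \<in> \<Union>C" for b b'
    proof -
      obtain X where "X \<in> C" "b \<in> X" "b' \<in> X"
        using b C(2) by blast
      then show ?thesis using C(1) unfolding orthonormal_in_def by blast
    qed
    then show "\<Union>C \<in> ?A"
      using C(1) unfolding orthonormal_in_def by blast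
  qed
  then obtain M where "M \<in> ?A" "\<forall>X\<in>?A. M \<subseteq> X \<longrightarrow> X = M" ..
  then show ?thesis by (intro exI[of _ M]) simp
qed

text \<open>The limit of the expansion of \<open>x\<close> along \<open>B\<close>. Its inner
  products determine it, so linearity and idempotence can be verified by testing against
  \<open>z\<close>.\<close>

definition proj :: "'a set \<Rightarrow> 'a \<Rightarrow> 'a" where
  "proj B x = (SOME y. y \<in> carrier H \<and>
     (\<forall>z\<in>carrier H. ((\<lambda>b. ip H z b * ip H b x) has_sum ip H z y) B))"

context
  fixes B :: "'a set"
  assumes B: "orthonormal_in H B"
begin

lemma proj_closed: "x \<in> carrier H \<Longrightarrow> proj B x \<in> carrier H"
  and ip_proj: "\<lbrakk>x \<in> carrier H; z \<in> carrier H\<rbrakk> \<Longrightarrow>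
    ((\<lambda>b. ip H z b * ip H b x) has_sum ip H z (proj B x)) B"
proof -
  assume x: "x \<in> carrier H"
  have "proj B x \<in> carrier H \<and>
     (\<forall>z\<in>carrier H. ((\<lambda>b. ip H z b * ip H b x) has_sum ip H z (proj B x)) B)"
    unfolding proj_def by (rule someI_ex) (use orthonormal_expansion[OF B x] in blast)
  then show "proj B x \<in> carrier H" and "z \<in> carrier H \<Longrightarrow>
    ((\<lambda>b. ip H z b * ip H b x) has_sum ip H z (proj B x)) B"
    by blast+
qed

lemma basis_closed: "b \<in> B \<Longrightarrow> b \<in> carrier H"
  using B unfolding orthonormal_in_def by blast

lemma ip_basis_proj:
  assumes "b \<in> B" "x \<in> carrier H"
  shows "ip H b (proj B x) = ip H b x"
proof -
  have "((\<lambda>b'. ip H b b' * ip H b' x) has_sum ip H b x) B"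
    by (rule has_sum_finite_neutralI[of "{b}"]) (use assms B in \<open>auto simp: orthonormal_in_def\<close>)
  then show ?thesis
    using ip_proj[OF assms(2) basis_closed[OF assms(1)]] has_sum_unique by blast
qed

lemma proj_self_adjoint:
  assumes "x \<in> carrier H" "y \<in> carrier H"
  shows "ip H (proj B x) y = ip H x (proj B y)"
proof -
  have "((\<lambda>b. cnj (ip H y b * ip H b x)) has_sum cnj (ip H y (proj B x))) B"
    using ip_proj[OF assms] by (simp only: has_sum_cnj_iff)
  moreover have "cnj (ip H y b * ip H b x) = ip H x b * ip H b y" if "b \<in> B" for b
    using assms basis_closed[OF that] ip_cnj[of y b] ip_cnj[of b x] by simp
  ultimately have "((\<lambda>b. ip H x b * ip H b y) has_sum cnj (ip H y (proj B x))) B"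
    by (simp cong: has_sum_cong)
  then have "cnj (ip H y (proj B x)) = ip H x (proj B y)"
    using ip_proj[OF assms(2,1)] has_sum_unique by blast
  then show ?thesis
    using ip_cnj[OF assms(2) proj_closed[OF assms(1)]] by simp
qed

lemma proj_idem:
  assumes "x \<in> carrier H"
  shows "proj B (proj B x) = proj B x"
proof (rule eq_if_ip_eq)
  fix z assume z: "z \<in> carrier H"
  have "((\<lambda>b. ip H z b * ip H b (proj B x)) has_sum ip H z (proj B (proj B x))) B"
    by (rule ip_proj[OF proj_closed[OF assms] z])
  then have "((\<lambda>b. ip H z b * ip H b x) has_sum ip H z (proj B (proj B x))) B"
    using ip_basis_proj[OF _ assms] by (simp cong: has_sum_cong)
  then show "ip H z (proj B (proj B x)) = ip H z (proj B x)"
    using ip_proj[OF assms z] has_sum_unique by blast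
qed (use assms proj_closed in auto)

lemma orthogonal_projection_proj: "orthogonal_projection H (proj B)"
  unfolding orthogonal_projection_def bounded_operator_def
proof (intro conjI ballI allI)
  show "proj B \<in> carrier H \<rightarrow> carrier H" using proj_closed by blast
  fix x assume x: "x \<in> carrier H"
  show "proj B (proj B x) = proj B x" by (rule proj_idem[OF x])
  show "proj B (c \<odot> x) = c \<odot> proj B x" for c
    by (rule eq_if_ip_eq) (use x proj_closed in
        \<open>simp_all add: ip_smult_right proj_self_adjoint[symmetric]\<close>)
  fix y assume y: "y \<in> carrier H"
  show "ip H (proj B x) y = ip H x (proj B y)" by (rule proj_self_adjoint[OF x y])
  show "proj B (x \<oplus> y) = proj B x \<oplus> proj B y"
    by (rule eq_if_ip_eq) (use x y proj_closed in
        \<open>simp_all add: ip_add_right proj_self_adjoint[symmetric]\<close>)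
next
  show "\<exists>K. \<forall>x\<in>carrier H. ip_norm H (proj B x) \<le> K * ip_norm H x"
  proof (intro exI ballI)
    fix x assume x: "x \<in> carrier H"
    have "ip_norm H (proj B x) \<le> ip_norm H x"
      by (rule norm_le_if_ip_eq[OF proj_closed[OF x] x])
         (simp add: proj_self_adjoint[OF x proj_closed[OF x]] proj_idem[OF x])
    then show "ip_norm H (proj B x) \<le> 1 * ip_norm H x" by simp
  qed
qed

lemma orthonormal_extend:
  assumes x: "x \<in> carrier H" "x \<noteq> \<zero>" "\<And>b. b \<in> B \<Longrightarrow> ip H b x = 0"
  shows "\<exists>c. c \<odot> x \<notin> B \<and> orthonormal_in H (insert (c \<odot> x) B)"
proof -
  define c where "c = complex_of_real (1 / ip_norm H x)"
  let ?u = "c \<odot> x"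
  have "ip_norm H x \<noteq> 0"
    using norm_square[OF x(1)] ip_definite[OF x(1)] x(2) by auto
  then have u: "ip H ?u ?u = 1"
    using x by (simp add: c_def ip_smult_right ip_smult_left norm_square[OF x(1)] power2_eq_square)
  have bu: "ip H b ?u = 0" "ip H ?u b = 0" if "b \<in> B" for b
    using x that basis_closed[OF that] ip_cnj[of b x] by (simp_all add: ip_smult_right ip_smult_left)
  have "?u \<notin> B" using bu u by fastforce
  moreover have "orthonormal_in H (insert ?u B)"
    using B u bu x(1) \<open>?u \<notin> B\<close> unfolding orthonormal_in_def by auto
  ultimately show ?thesis by blast
qed

end

lemma orthonormal_basis_exists: "\<exists>B. orthonormal_basis H B"
proof -
  obtain B where "orthonormal_in H B"
    "\<forall>B'. orthonormal_in H B' \<and> B' \<subseteq> carrier H \<and> B \<subseteq> B' \<longrightarrow> B' = B"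
    using maximal_orthonormal[of "carrier H"] by blast
  then have "orthonormal_basis H B"
    unfolding orthonormal_basis_def orthonormal_in_def by blast
  then show ?thesis ..
qed

text \<open>The part of \<open>y\<close> missed by its expansion is orthogonal to \<open>B\<close>;
  if nonzero, its normalisation would enlarge the maximal set.\<close>

lemma Parseval:
  assumes B: "orthonormal_basis H B" and x: "x \<in> carrier H" and y: "y \<in> carrier H"
  shows "((\<lambda>b. ip H x b * ip H b y) has_sum ip H x y) B"
proof -
  have on: "orthonormal_in H B" using B unfolding orthonormal_basis_def by blast
  have py: "proj B y \<in> carrier H" by (rule proj_closed[OF on y])
  have "y \<ominus> proj B y = \<zero>"
  proof (rule ccontr)
    assume "y \<ominus> proj B y \<noteq> \<zero>"
    moreover have "ip H b (y \<ominus> proj B y) = 0" if "b \<in> B" for b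
      using that basis_closed[OF on that] y py by (simp add: ip_diff_right ip_basis_proj[OF on])
    ultimately obtain c where "c \<odot> (y \<ominus> proj B y) \<notin> B"
      "orthonormal_in H (insert (c \<odot> (y \<ominus> proj B y)) B)"
      using orthonormal_extend[OF on, of "y \<ominus> proj B y"] y py by auto
    then show False using B unfolding orthonormal_basis_def by blast
  qed
  then have "y = proj B y" by (rule eq_if_diff_zero[OF y py])
  then show ?thesis using ip_proj[OF on y x] by simp
qed

text \<open>The double orthogonal complement \<open>S\<close> stands in for the closed span, so
  neither spans nor closures are formed. For \<open>t \<in> T\<close> the defect of the expansion
  lies in \<open>S\<close> and is orthogonal to \<open>B\<close>, hence zero by maximality within
  \<open>S\<close>. A vector orthogonal to \<open>T\<close> is orthogonal to \<open>S\<close>, in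
  particular to \<open>B\<close>, and is killed.\<close>

lemma projection_onto_span:
  assumes T: "T \<subseteq> carrier H"
  shows "\<exists>P. orthogonal_projection H P \<and> (\<forall>t\<in>T. P t = t) \<and>
    (\<forall>x\<in>carrier H. (\<forall>t\<in>T. ip H t x = 0) \<longrightarrow> P x = \<zero>)"
proof -
  define perp where "perp = {x \<in> carrier H. \<forall>t\<in>T. ip H t x = 0}"
  define S where "S = {x \<in> carrier H. \<forall>z\<in>perp. ip H z x = 0}"
  obtain B where on: "orthonormal_in H B" and BS: "B \<subseteq> S"
    and maximal: "\<And>B'. orthonormal_in H B' \<Longrightarrow> B' \<subseteq> S \<Longrightarrow> B \<subseteq> B' \<Longrightarrow> B' = B"
    using maximal_orthonormal[of S] by (elim exE conjE) simp
  have perp_carrier: "z \<in> carrier H" if "z \<in> perp" for z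
    using that by (simp add: perp_def)
  have perp_B: "ip H b z = 0" "ip H z b = 0" if "b \<in> B" "z \<in> perp" for b z
    using that BS perp_carrier[OF that(2)] ip_cnj[of z b] by (auto simp: S_def)
  have "proj B t = t" if "t \<in> T" for t
  proof -
    have t: "t \<in> carrier H" using that T by blast
    have pt: "proj B t \<in> carrier H" by (rule proj_closed[OF on t])
    have "t \<ominus> proj B t = \<zero>"
    proof (rule ccontr)
      assume "t \<ominus> proj B t \<noteq> \<zero>"
      moreover have "ip H b (t \<ominus> proj B t) = 0" if "b \<in> B" for b
        using that basis_closed[OF on that] t pt by (simp add: ip_diff_right ip_basis_proj[OF on])
      ultimately obtain c where c: "c \<odot> (t \<ominus> proj B t) \<notin> B"
        "orthonormal_in H (insert (c \<odot> (t \<ominus> proj B t)) B)"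
        using orthonormal_extend[OF on, of "t \<ominus> proj B t"] t pt by auto
      have "ip H z (t \<ominus> proj B t) = 0" if z: "z \<in> perp" for z
      proof -
        have "((\<lambda>b. ip H z b * ip H b t) has_sum 0) B"
          using perp_B z by (intro has_sum_0) auto
        then have "ip H z (proj B t) = 0"
          using ip_proj[OF on t perp_carrier[OF z]] has_sum_unique by blast
        moreover have "ip H z t = 0"
          using z \<open>t \<in> T\<close> t ip_cnj[of t z] by (simp add: perp_def)
        ultimately show ?thesis
          using perp_carrier[OF z] t pt by (simp add: ip_diff_right)
      qed
      then have "c \<odot> (t \<ominus> proj B t) \<in> S"
        using t pt perp_carrier by (simp add: S_def ip_smult_right)
      then show False using maximal[OF c(2)] c(1) BS by blast
    qed
    then show ?thesis using eq_if_diff_zero[OF t pt] by simp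
  qed
  moreover have "proj B x = \<zero>" if x: "x \<in> carrier H" "\<forall>t\<in>T. ip H t x = 0" for x
  proof (rule eq_if_ip_eq)
    fix z assume z: "z \<in> carrier H"
    have "x \<in> perp" using x by (simp add: perp_def)
    then have "((\<lambda>b. ip H z b * ip H b x) has_sum 0) B"
      using perp_B by (intro has_sum_0) auto
    then show "ip H z (proj B x) = ip H z \<zero>"
      using ip_proj[OF on x(1) z] has_sum_unique z by fastforce
  qed (use x proj_closed[OF on] in auto)
  ultimately show ?thesis
    using orthogonal_projection_proj[OF on] by blast
qed

lemma projection_bounded: "orthogonal_projection H P \<Longrightarrow> bounded_operator H P"
  unfolding orthogonal_projection_def by blast

lemma projection_closed: "orthogonal_projection H P \<Longrightarrow> x \<in> carrier H \<Longrightarrow> P x \<in> carrier H"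
  by (rule bounded_operator_closed[OF projection_bounded])

lemma projection_self_adjoint:
  "orthogonal_projection H P \<Longrightarrow> x \<in> carrier H \<Longrightarrow> y \<in> carrier H \<Longrightarrow> ip H (P x) y = ip H x (P y)"
  unfolding orthogonal_projection_def by blast

lemma projection_idem:
  "orthogonal_projection H P \<Longrightarrow> x \<in> carrier H \<Longrightarrow> P (P x) = P x"
  unfolding orthogonal_projection_def by blast

lemma some_orthonormal_basis: "orthonormal_basis H (SOME B. orthonormal_basis H B)"
  by (rule someI_ex) (rule orthonormal_basis_exists)

lemma orthogonal_projection_id: "orthogonal_projection H (\<lambda>x. x)"
  unfolding orthogonal_projection_def by (simp add: bounded_operator_id)

lemma projection_contraction:
  assumes P: "orthogonal_projection H P" and x: "x \<in> carrier H"
  shows "ip_norm H (P x) \<le> ip_norm H x"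
proof (rule norm_le_if_ip_eq[OF projection_closed[OF P x] x])
  show "ip H (P x) (P x) = ip H x (P x)"
    using projection_self_adjoint[OF P x projection_closed[OF P x]] projection_idem[OF P x] by simp
qed

end

section \<open>Square-summable sequences\<close>

lemma cring_complex_ring: "cring complex_ring"
proof (rule cringI)
  show "abelian_group complex_ring"
  proof (rule abelian_groupI)
    fix x assume "x \<in> carrier complex_ring"
    show "\<exists>y\<in>carrier complex_ring. y \<oplus>\<^bsub>complex_ring\<^esub> x = \<zero>\<^bsub>complex_ring\<^esub>"
      by (intro bexI[of _ "- x"]) simp_all
  qed (simp_all add: algebra_simps)
  show "Group.comm_monoid complex_ring"
    by (rule comm_monoidI) (simp_all add: algebra_simps)
qed (simp_all add: algebra_simps)

text \<open>The support set \<open>J\<close> allows coordinates to be dropped. A degenerate kernel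
  has zero pivots, and with their coordinates kept its vectors would not be total.\<close>

definition ell2 :: "nat set \<Rightarrow> (nat \<Rightarrow> complex) inner_space" where
  "ell2 J = \<lparr>carrier = {f. (\<forall>n. n \<notin> J \<longrightarrow> f n = 0) \<and> summable (\<lambda>n. (cmod (f n))\<^sup>2)},
    monoid.mult = (\<lambda>f g. f), one = (\<lambda>_. 0), ring.zero = (\<lambda>_. 0), add = (\<lambda>f g n. f n + g n),
    smult = (\<lambda>c f n. c * f n), ip = (\<lambda>f g. \<Sum>n. cnj (f n) * g n)\<rparr>"

lemma ell2_simps [simp]:
  "f \<in> carrier (ell2 J) \<longleftrightarrow> (\<forall>n. n \<notin> J \<longrightarrow> f n = 0) \<and> summable (\<lambda>n. (cmod (f n))\<^sup>2)"
  "\<zero>\<^bsub>ell2 J\<^esub> = (\<lambda>_. 0)"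
  "f \<oplus>\<^bsub>ell2 J\<^esub> g = (\<lambda>n. f n + g n)"
  "c \<odot>\<^bsub>ell2 J\<^esub> f = (\<lambda>n. c * f n)"
  "ip (ell2 J) f g = (\<Sum>n. cnj (f n) * g n)"
  by (simp_all add: ell2_def)

lemma norm_add_squared_le: "(cmod (a + b))\<^sup>2 \<le> 2 * (cmod a)\<^sup>2 + 2 * (cmod b)\<^sup>2"
proof -
  have "(cmod (a + b))\<^sup>2 \<le> (cmod a + cmod b)\<^sup>2"
    by (intro power_mono norm_triangle_ineq) simp
  also have "\<dots> \<le> 2 * (cmod a)\<^sup>2 + 2 * (cmod b)\<^sup>2"
    using zero_le_power2[of "cmod a - cmod b"] by (simp add: power2_eq_square algebra_simps)
  finally show ?thesis .
qed

lemma norm_mult_le_squares: "cmod (cnj a * b) \<le> (cmod a)\<^sup>2 + (cmod b)\<^sup>2"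
proof -
  have "2 * (cmod a * cmod b) \<le> (cmod a)\<^sup>2 + (cmod b)\<^sup>2"
    using zero_le_power2[of "cmod a - cmod b"] by (simp add: power2_eq_square algebra_simps)
  moreover have "0 \<le> cmod a * cmod b" by simp
  ultimately show ?thesis by (simp only: norm_mult complex_mod_cnj)
qed

lemma summable_squares_add:
  assumes "summable (\<lambda>n. (cmod (f n))\<^sup>2)" "summable (\<lambda>n. (cmod (g n))\<^sup>2)"
  shows "summable (\<lambda>n. (cmod (f n + g n))\<^sup>2)"
  by (rule summable_comparison_test'[where N = 0, OF summable_add[OF summable_mult[OF assms(1), of 2] summable_mult[OF assms(2), of 2]]])
     (simp add: norm_add_squared_le)

lemma summable_squares_mult:
  assumes "summable (\<lambda>n. (cmod (f n))\<^sup>2)" "summable (\<lambda>n. (cmod (g n))\<^sup>2)"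
  shows "summable (\<lambda>n. cnj (f n) * g n)"
  by (rule summable_comparison_test'[where N = 0, OF summable_add[OF assms]])
     (rule norm_mult_le_squares)

lemma abelian_group_ell2: "abelian_group (ell2 J)"
proof (rule abelian_groupI)
  fix f assume f: "f \<in> carrier (ell2 J)"
  then show "\<exists>g\<in>carrier (ell2 J). g \<oplus>\<^bsub>ell2 J\<^esub> f = \<zero>\<^bsub>ell2 J\<^esub>"
    by (intro bexI[of _ "\<lambda>n. - f n"]) simp_all
qed (simp_all add: summable_squares_add algebra_simps)

lemma module_ell2: "module complex_ring (ell2 J)"
proof (rule moduleI[OF cring_complex_ring abelian_group_ell2])
  fix c f assume "f \<in> carrier (ell2 J)"
  then show "c \<odot>\<^bsub>ell2 J\<^esub> f \<in> carrier (ell2 J)"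
    by (simp add: norm_mult power_mult_distrib summable_mult)
qed (simp_all add: algebra_simps)

lemma minus_ell2:
  assumes "f \<in> carrier (ell2 J)" "g \<in> carrier (ell2 J)"
  shows "f \<ominus>\<^bsub>ell2 J\<^esub> g = (\<lambda>n. f n - g n)"
proof -
  have "\<ominus>\<^bsub>ell2 J\<^esub> g = (\<lambda>n. - g n)"
    by (rule abelian_group.minus_equality[OF abelian_group_ell2]) (use assms in simp_all)
  then show ?thesis by (simp add: a_minus_def)
qed

lemma ip_ell2_self:
  assumes "summable (\<lambda>n. (cmod (f n))\<^sup>2)"
  shows "ip (ell2 J) f f = of_real (\<Sum>n. (cmod (f n))\<^sup>2)"
proof -
  have "cnj (f n) * f n = of_real ((cmod (f n))\<^sup>2)" for n
    using complex_norm_square[of "f n"] by (simp add: mult.commute)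
  then show ?thesis using suminf_of_real[OF assms, where 'a = complex] by simp
qed

lemma ip_norm_ell2:
  assumes "summable (\<lambda>n. (cmod (f n))\<^sup>2)"
  shows "ip_norm (ell2 J) f = sqrt (\<Sum>n. (cmod (f n))\<^sup>2)"
  unfolding ip_norm_def ip_ell2_self[OF assms] by simp

lemma complete_ell2:
  assumes f: "\<And>n. f n \<in> carrier (ell2 J)"
    and Cauchy: "\<And>e. e > 0 \<Longrightarrow> \<exists>N. \<forall>m\<ge>N. \<forall>n\<ge>N. ip_norm (ell2 J) (f m \<ominus>\<^bsub>ell2 J\<^esub> f n) < e"
  shows "\<exists>x\<in>carrier (ell2 J). (\<lambda>n. ip_norm (ell2 J) (f n \<ominus>\<^bsub>ell2 J\<^esub> x)) \<longlonglongrightarrow> 0"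
proof -
  have fs: "summable (\<lambda>k. (cmod (f n k))\<^sup>2)" for n using f[of n] by simp
  have fd: "summable (\<lambda>k. (cmod (f m k - f n k))\<^sup>2)" for m n
    using summable_squares_add[OF fs[of m], of "\<lambda>k. - f n k"] fs[of n] by simp
  have nd: "ip_norm (ell2 J) (f m \<ominus>\<^bsub>ell2 J\<^esub> f n) = sqrt (\<Sum>k. (cmod (f m k - f n k))\<^sup>2)" for m n
    unfolding minus_ell2[OF f f] by (rule ip_norm_ell2[OF fd])
  \<comment> \<open>Bounds on finite partial sums, uniform in their length, survive the
    coordinatewise limit in \<open>m\<close>; the full series cannot be passed to the limit
    directly.\<close>
  have partial: "\<exists>N. \<forall>m\<ge>N. \<forall>n\<ge>N. \<forall>K. (\<Sum>k<K. (cmod (f m k - f n k))\<^sup>2) \<le> e\<^sup>2" if "e > 0" for e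
  proof -
    obtain N where N: "\<forall>m\<ge>N. \<forall>n\<ge>N. ip_norm (ell2 J) (f m \<ominus>\<^bsub>ell2 J\<^esub> f n) < e"
      using Cauchy[OF \<open>e > 0\<close>] by blast
    have "(\<Sum>k<K. (cmod (f m k - f n k))\<^sup>2) \<le> e\<^sup>2" if "m \<ge> N" "n \<ge> N" for m n K
    proof -
      have "sqrt (\<Sum>k. (cmod (f m k - f n k))\<^sup>2) \<le> e"
        using N that unfolding nd by (meson less_imp_le)
      then have "(\<Sum>k. (cmod (f m k - f n k))\<^sup>2) \<le> e\<^sup>2"
        by (rule sqrt_le_D)
      moreover have "(\<Sum>k<K. (cmod (f m k - f n k))\<^sup>2) \<le> (\<Sum>k. (cmod (f m k - f n k))\<^sup>2)"
        by (rule sum_le_suminf[OF fd]) auto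
      ultimately show ?thesis by linarith
    qed
    then show ?thesis by blast
  qed
  have "\<exists>l. (\<lambda>n. f n k) \<longlonglongrightarrow> l" for k
  proof -
    have "Cauchy (\<lambda>n. f n k)"
    proof (rule metric_CauchyI)
      fix e :: real assume "e > 0"
      then obtain N where N: "\<forall>m\<ge>N. \<forall>n\<ge>N. \<forall>K. (\<Sum>k<K. (cmod (f m k - f n k))\<^sup>2) \<le> (e / 2)\<^sup>2"
        using partial[of "e / 2"] by auto
      have "dist (f m k) (f n k) < e" if "m \<ge> N" "n \<ge> N" for m n
      proof -
        have "(cmod (f m k - f n k))\<^sup>2 \<le> (\<Sum>k<Suc k. (cmod (f m k - f n k))\<^sup>2)"
          by (rule member_le_sum) auto
        also have "\<dots> \<le> (e / 2)\<^sup>2" using N that by blast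
        finally have "cmod (f m k - f n k) \<le> e / 2"
          by (rule power2_le_imp_le) (use \<open>e > 0\<close> in simp)
        then show ?thesis using \<open>e > 0\<close> by (simp add: dist_norm)
      qed
      then show "\<exists>M. \<forall>m\<ge>M. \<forall>n\<ge>M. dist (f m k) (f n k) < e" by blast
    qed
    then show ?thesis by (simp add: Cauchy_convergent_iff convergent_def)
  qed
  then obtain g where g: "\<And>k. (\<lambda>n. f n k) \<longlonglongrightarrow> g k" by metis
  have gJ: "g k = 0" if "k \<notin> J" for k
  proof -
    have "(\<lambda>n. f n k) = (\<lambda>_. 0)" using f that by auto
    then show ?thesis using g[of k] LIMSEQ_unique[OF _ tendsto_const] by metis
  qed
  have limit: "\<exists>N. \<forall>n\<ge>N. \<forall>K. (\<Sum>k<K. (cmod (f n k - g k))\<^sup>2) \<le> e\<^sup>2" if "e > 0" for e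
  proof -
    obtain N where N: "\<forall>m\<ge>N. \<forall>n\<ge>N. \<forall>K. (\<Sum>k<K. (cmod (f m k - f n k))\<^sup>2) \<le> e\<^sup>2"
      using partial[OF \<open>e > 0\<close>] by blast
    have "(\<Sum>k<K. (cmod (f n k - g k))\<^sup>2) \<le> e\<^sup>2" if "n \<ge> N" for n K
    proof (rule LIMSEQ_le_const2)
      show "(\<lambda>m. \<Sum>k<K. (cmod (f n k - f m k))\<^sup>2) \<longlonglongrightarrow> (\<Sum>k<K. (cmod (f n k - g k))\<^sup>2)"
        by (intro tendsto_intros g)
      show "\<exists>N. \<forall>m\<ge>N. (\<Sum>k<K. (cmod (f n k - f m k))\<^sup>2) \<le> e\<^sup>2"
        using N that by blast
    qed
    then show ?thesis by blast
  qed
  have diff: "summable (\<lambda>k. (cmod (f n k - g k))\<^sup>2) \<and> (\<Sum>k. (cmod (f n k - g k))\<^sup>2) \<le> e\<^sup>2"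
    if "\<forall>K. (\<Sum>k<K. (cmod (f n k - g k))\<^sup>2) \<le> e\<^sup>2" for n e
  proof
    show s: "summable (\<lambda>k. (cmod (f n k - g k))\<^sup>2)"
      by (rule bounded_imp_summable[where B = "e\<^sup>2"])
         (use that[rule_format, of "Suc n" for n] in \<open>auto simp: lessThan_Suc_atMost\<close>)
    show "(\<Sum>k. (cmod (f n k - g k))\<^sup>2) \<le> e\<^sup>2"
      by (rule suminf_le_const[OF s]) (use that in blast)
  qed
  obtain N where N: "\<forall>n\<ge>N. \<forall>K. (\<Sum>k<K. (cmod (f n k - g k))\<^sup>2) \<le> 1\<^sup>2"
    using limit[of 1] by auto
  have "summable (\<lambda>k. (cmod (f N k - g k))\<^sup>2)"
    using diff[of N 1] N by blast
  then have "summable (\<lambda>k. (cmod (f N k + - (f N k - g k)))\<^sup>2)"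
    by (intro summable_squares_add fs) (simp add: norm_minus_commute)
  then have gs: "summable (\<lambda>k. (cmod (g k))\<^sup>2)" by simp
  then have gc: "g \<in> carrier (ell2 J)" using gJ by simp
  have gd: "ip_norm (ell2 J) (f n \<ominus>\<^bsub>ell2 J\<^esub> g) = sqrt (\<Sum>k. (cmod (f n k - g k))\<^sup>2)" for n
    unfolding minus_ell2[OF f gc]
    by (rule ip_norm_ell2) (use summable_squares_add[OF fs[of n], of "\<lambda>k. - g k"] gs in simp)
  have "(\<lambda>n. ip_norm (ell2 J) (f n \<ominus>\<^bsub>ell2 J\<^esub> g)) \<longlonglongrightarrow> 0"
  proof (rule LIMSEQ_I)
    fix e :: real assume "e > 0"
    then obtain N where N: "\<forall>n\<ge>N. \<forall>K. (\<Sum>k<K. (cmod (f n k - g k))\<^sup>2) \<le> (e / 2)\<^sup>2"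
      using limit[of "e / 2"] by auto
    have "norm (ip_norm (ell2 J) (f n \<ominus>\<^bsub>ell2 J\<^esub> g) - 0) < e" if "n \<ge> N" for n
    proof -
      have d: "summable (\<lambda>k. (cmod (f n k - g k))\<^sup>2)" "(\<Sum>k. (cmod (f n k - g k))\<^sup>2) \<le> (e / 2)\<^sup>2"
        using diff[of n "e / 2"] N that by blast+
      have "sqrt (\<Sum>k. (cmod (f n k - g k))\<^sup>2) \<le> e / 2"
        using d(2) \<open>e > 0\<close> by (intro real_le_lsqrt) auto
      moreover have "0 \<le> sqrt (\<Sum>k. (cmod (f n k - g k))\<^sup>2)"
        using suminf_nonneg[OF d(1)] by simp
      ultimately show ?thesis unfolding gd using \<open>e > 0\<close> by simp
    qed
    then show "\<exists>N. \<forall>n\<ge>N. norm (ip_norm (ell2 J) (f n \<ominus>\<^bsub>ell2 J\<^esub> g) - 0) < e" by blast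
  qed
  then show ?thesis using gc by blast
qed

lemma complex_hilbert_space_ell2: "complex_hilbert_space (ell2 J)"
proof (rule complex_hilbert_space.intro[OF module_ell2], unfold_locales)
  fix x y z :: "nat \<Rightarrow> complex" and c
  assume x: "x \<in> carrier (ell2 J)" and y: "y \<in> carrier (ell2 J)"
  then have xy: "summable (\<lambda>n. cnj (x n) * y n)"
    by (intro summable_squares_mult) simp_all
  show "ip (ell2 J) x (c \<odot>\<^bsub>ell2 J\<^esub> y) = c * ip (ell2 J) x y"
    using suminf_mult[OF xy, of c] by (simp add: algebra_simps)
  show "ip (ell2 J) y x = cnj (ip (ell2 J) x y)"
  proof -
    have "(\<lambda>n. cnj (cnj (x n) * y n)) sums cnj (\<Sum>n. cnj (x n) * y n)"
      using summable_sums[OF xy] by (simp only: sums_cnj)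
    then show ?thesis by (simp add: sums_iff mult.commute)
  qed
  assume z: "z \<in> carrier (ell2 J)"
  then have xz: "summable (\<lambda>n. cnj (x n) * z n)"
    using x by (intro summable_squares_mult) simp_all
  show "ip (ell2 J) x (y \<oplus>\<^bsub>ell2 J\<^esub> z) = ip (ell2 J) x y + ip (ell2 J) x z"
    using suminf_add[OF xy xz] by (simp add: algebra_simps)
next
  fix x :: "nat \<Rightarrow> complex"
  assume x: "x \<in> carrier (ell2 J)"
  then have s: "summable (\<lambda>n. (cmod (x n))\<^sup>2)" by simp
  show "ip (ell2 J) x x \<in> \<real>\<^sub>\<ge>\<^sub>0"
    unfolding ip_ell2_self[OF s] using suminf_nonneg[OF s] by simp
  assume "ip (ell2 J) x x = 0"
  then have "(\<Sum>n. (cmod (x n))\<^sup>2) = 0"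
    unfolding ip_ell2_self[OF s] by simp
  then have "x n = 0" for n
    using suminf_eq_zero_iff[OF s] by simp
  then show "x = \<zero>\<^bsub>ell2 J\<^esub>" by auto
qed (rule complete_ell2)

text \<open>The coordinates of \<open>\<xi> x\<close> are the column of the Cholesky factor at
  \<open>x\<close>. The column of \<open>e j\<close> ends at coordinate \<open>j\<close>, so inner
  products are finite sums. Totality is forward substitution in a triangular system whose diagonal
  is nonzero on \<open>J\<close>, while \<open>f\<close> vanishes off \<open>J\<close>.\<close>

lemma kernel_realization:
  assumes psd: "psd_kernel X K" and X: "countable X" "X \<noteq> {}"
  obtains J \<xi> where "\<And>x. x \<in> X \<Longrightarrow> \<xi> x \<in> carrier (ell2 J)"
    and "\<And>x y. x \<in> X \<Longrightarrow> y \<in> X \<Longrightarrow> ip (ell2 J) (\<xi> x) (\<xi> y) = K x y"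
    and "\<And>f. f \<in> carrier (ell2 J) \<Longrightarrow> (\<And>x. x \<in> X \<Longrightarrow> ip (ell2 J) (\<xi> x) f = 0) \<Longrightarrow> f = \<zero>\<^bsub>ell2 J\<^esub>"
proof -
  define e where "e = from_nat_into X"
  have e: "e n \<in> X" for n unfolding e_def by (rule from_nat_into[OF X(2)])
  have range_e: "range e = X" unfolding e_def by (rule range_from_nat_into[OF X(2,1)])
  define \<xi> where "\<xi> x = (\<lambda>k. cholesky K e k x)" for x
  define J where "J = {k. cholesky K e k (e k) \<noteq> 0}"
  have triangular: "\<xi> (e j) k = 0" if "\<not> k \<le> j" for j k
    unfolding \<xi>_def by (rule cholesky_triangular[OF psd e]) (use that in simp)
  have ip_\<xi>: "ip (ell2 J) (\<xi> (e j)) f = (\<Sum>k<Suc j. cnj (\<xi> (e j) k) * f k)" for j f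
    unfolding ell2_simps
    by (rule suminf_finite) (auto simp: triangular)
  have \<xi>: "\<xi> (e j) \<in> carrier (ell2 J)" for j
  proof -
    have "summable (\<lambda>k. (cmod (\<xi> (e j) k))\<^sup>2)"
      by (rule summable_finite[of "{..j}"]) (auto simp: triangular)
    then show ?thesis
      using cholesky_pivot_zero[OF psd e _ e] by (auto simp: \<xi>_def J_def)
  qed
  show thesis
  proof (rule that[of \<xi> J])
    fix x assume "x \<in> X"
    then obtain j where j: "x = e j" using range_e by auto
    show "\<xi> x \<in> carrier (ell2 J)" unfolding j by (rule \<xi>)
    fix y assume y: "y \<in> X"
    show "ip (ell2 J) (\<xi> x) (\<xi> y) = K x y"
      unfolding j ip_\<xi> unfolding \<xi>_def
      by (rule cholesky_decomposition[OF psd e _ y, symmetric]) simp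
  next
    fix f assume f: "f \<in> carrier (ell2 J)" and orth: "\<And>x. x \<in> X \<Longrightarrow> ip (ell2 J) (\<xi> x) f = 0"
    have "f k = 0" for k
    proof (induction k rule: less_induct)
      case (less k)
      have "0 = (\<Sum>i<Suc k. cnj (\<xi> (e k) i) * f i)"
        using orth[OF e] unfolding ip_\<xi> by simp
      also have "\<dots> = cnj (\<xi> (e k) k) * f k"
        using less by simp
      finally show ?case using f by (cases "k \<in> J") (auto simp: J_def \<xi>_def)
    qed
    then show "f = \<zero>\<^bsub>ell2 J\<^esub>" by auto
  qed
qed

section \<open>Vector states and their traces\<close>

context complex_hilbert_space
begin

definition rank_one :: "'a \<Rightarrow> 'a \<Rightarrow> 'a" where
  "rank_one \<psi> x = ip H \<psi> x \<odot> \<psi>"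

context
  fixes \<psi> assumes \<psi>: "\<psi> \<in> carrier H" and unit: "ip H \<psi> \<psi> = 1"
begin

lemma bounded_operator_rank_one: "bounded_operator H (rank_one \<psi>)"
  unfolding bounded_operator_def rank_one_def
proof (intro conjI ballI allI)
  have norm: "ip_norm H (c \<odot> \<psi>) = cmod c" for c
  proof -
    have "ip H (c \<odot> \<psi>) (c \<odot> \<psi>) = of_real ((cmod c)\<^sup>2)"
      using \<psi> unit complex_norm_square[of c] by (simp add: ip_smult_left ip_smult_right)
    then show ?thesis by (simp add: ip_norm_def)
  qed
  show "\<exists>K. \<forall>x\<in>carrier H. ip_norm H (ip H \<psi> x \<odot> \<psi>) \<le> K * ip_norm H x"
    unfolding norm using Cauchy_Schwarz[OF \<psi>] by blast
qed (use \<psi> in \<open>simp_all add: ip_add_right ip_smult_right smult_l_distr[simplified] smult_assoc1[simplified]\<close>)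

lemma positive_operator_rank_one: "positive_operator H (rank_one \<psi>)"
  unfolding positive_operator_def
proof (intro conjI ballI bounded_operator_rank_one)
  fix x assume x: "x \<in> carrier H"
  have "ip H x (rank_one \<psi> x) = of_real ((cmod (ip H \<psi> x))\<^sup>2)"
    using x \<psi> ip_cnj[OF \<psi> x] complex_norm_square[of "ip H \<psi> x"]
    by (simp add: rank_one_def ip_smult_right)
  then show "ip H x (rank_one \<psi> x) \<in> \<real>\<^sub>\<ge>\<^sub>0"
    by (simp add: complex_nonneg_Reals_iff del: of_real_power)
qed

text \<open>Since \<open>P\<close> is self-adjoint, the summand at \<open>b\<close> is
  \<open>ip H (P \<psi>) b * ip H b \<psi>\<close>, so the trace is a Parseval series.\<close>

lemma op_trace_rank_one_projection:
  assumes P: "orthogonal_projection H P"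
  shows "op_trace H (rank_one \<psi> \<circ> P) = ip H (P \<psi>) \<psi>"
  unfolding op_trace_def
proof (rule infsumI)
  let ?B = "SOME B. orthonormal_basis H B"
  have "ip H b ((rank_one \<psi> \<circ> P) b) = ip H (P \<psi>) b * ip H b \<psi>" if "b \<in> ?B" for b
  proof -
    have b: "b \<in> carrier H"
      using some_orthonormal_basis that unfolding orthonormal_basis_def orthonormal_in_def by blast
    then show ?thesis
      using \<psi> projection_self_adjoint[OF P \<psi> b] by (simp add: rank_one_def ip_smult_right)
  qed
  then show "((\<lambda>b. ip H b ((rank_one \<psi> \<circ> P) b)) has_sum ip H (P \<psi>) \<psi>) ?B"
    using Parseval[OF some_orthonormal_basis projection_closed[OF P \<psi>] \<psi>]
    by (simp cong: has_sum_cong)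
qed

lemma density_operator_rank_one: "density_operator H (rank_one \<psi>)"
  unfolding density_operator_def
proof (intro conjI positive_operator_rank_one)
  show "op_trace H (rank_one \<psi>) = 1"
    using op_trace_rank_one_projection[OF orthogonal_projection_id] unit by (simp add: comp_def)
  obtain B where B: "orthonormal_basis H B" using orthonormal_basis_exists by blast
  have "ip H b (rank_one \<psi> b) = ip H \<psi> b * ip H b \<psi>" if "b \<in> B" for b
    using that B \<psi> unfolding orthonormal_basis_def orthonormal_in_def
    by (auto simp: rank_one_def ip_smult_right subset_iff)
  then have "(\<lambda>b. ip H b (rank_one \<psi> b)) summable_on B"
    using has_sum_imp_summable[OF Parseval[OF B \<psi> \<psi>]] by (simp cong: summable_on_cong)
  \<comment> \<open>Being positive, the operator is its own absolute value.\<close>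
  then show "trace_class H (rank_one \<psi>)"
    unfolding trace_class_def using bounded_operator_rank_one positive_operator_rank_one B by blast
qed

end

end

section \<open>From the hierarchy to a quantum model\<close>

text \<open>A certificate of infinite level. The index set is no longer finite, so positivity is
  demanded on its finite subsets.\<close>

definition moment_matrix :: "'v set \<Rightarrow> 'v set set \<Rightarrow> ('v list \<Rightarrow> 'v list \<Rightarrow> complex) \<Rightarrow> bool" where
  "moment_matrix V E M \<longleftrightarrow>
     psd_kernel (lists V) M \<and> M [] [] = 1 \<and>
     (\<forall>e\<in>E. \<forall>v\<in>lists V. \<forall>w\<in>lists V. (\<Sum>x\<in>e. M (v @ [x]) w) = M v w) \<and>
     (\<forall>v\<in>lists V. \<forall>w\<in>lists V.
        v \<noteq> [] \<and> w \<noteq> [] \<and> orth E (last v) (last w) \<longrightarrow> M v w = 0)"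

lemma quantum_model_of_moment_matrix:
  assumes H: "contextuality_scenario V E" and M: "moment_matrix V E M"
    and p: "p \<in> V \<rightarrow>\<^sub>E {0..1}" and pM: "\<And>v. v \<in> V \<Longrightarrow> complex_of_real (p v) = M [v] []"
  shows "p \<in> quantum_models TYPE(nat \<Rightarrow> complex) V E"
proof -
  have V: "finite V" "\<And>e. e \<in> E \<Longrightarrow> e \<subseteq> V" "\<Union>E = V"
    using H unfolding contextuality_scenario_def by auto
  have fin: "finite e" if "e \<in> E" for e
    using finite_subset[OF V(2)[OF that] V(1)] .
  have psd: "psd_kernel (lists V) M" and M1: "M [] [] = 1"
    and Msum: "\<And>e v w. e \<in> E \<Longrightarrow> v \<in> lists V \<Longrightarrow> w \<in> lists V \<Longrightarrow> (\<Sum>x\<in>e. M (v @ [x]) w) = M v w"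
    and Morth: "\<And>v w x y. v \<in> lists V \<Longrightarrow> w \<in> lists V \<Longrightarrow> x \<in> V \<Longrightarrow> y \<in> V \<Longrightarrow> orth E x y \<Longrightarrow>
      M (v @ [x]) (w @ [y]) = 0"
    using M unfolding moment_matrix_def by auto
  have "lists V \<noteq> {}" "countable (lists V)"
    using V(1) by (auto intro: countable_lists countable_finite)
  then obtain J \<xi> where \<xi>: "\<And>w. w \<in> lists V \<Longrightarrow> \<xi> w \<in> carrier (ell2 J)"
    and ip_\<xi>: "\<And>v w. v \<in> lists V \<Longrightarrow> w \<in> lists V \<Longrightarrow> ip (ell2 J) (\<xi> v) (\<xi> w) = M v w"
    and total: "\<And>f. f \<in> carrier (ell2 J) \<Longrightarrow> (\<And>w. w \<in> lists V \<Longrightarrow> ip (ell2 J) (\<xi> w) f = 0) \<Longrightarrow>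
      f = \<zero>\<^bsub>ell2 J\<^esub>"
    using kernel_realization[OF psd] by (metis (no_types, lifting))
  define H where "H = ell2 J"
  interpret complex_hilbert_space H
    unfolding H_def by (rule complex_hilbert_space_ell2)
  note \<xi> = \<xi>[folded H_def] and ip_\<xi> = ip_\<xi>[folded H_def] and total = total[folded H_def]
  have eq_if_total: "x = y"
    if xy: "x \<in> carrier H" "y \<in> carrier H" and eq: "\<And>w. w \<in> lists V \<Longrightarrow> ip H (\<xi> w) x = ip H (\<xi> w) y" for x y
  proof (rule eq_if_diff_zero[OF xy], rule total)
    fix w assume w: "w \<in> lists V"
    show "ip H (\<xi> w) (x \<ominus>\<^bsub>H\<^esub> y) = 0"
      by (simp add: ip_diff_right[OF \<xi>[OF w] xy] eq[OF w])
  qed (use xy in simp)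
  have snoc: "w @ [v] \<in> lists V" if "w \<in> lists V" "v \<in> V" for w v
    using that by simp
  \<comment> \<open>The sum rule concerns the left index of \<open>M\<close>. Conjugation moves it
    to the right argument of the inner product, and totality turns it into an equation of
    vectors.\<close>
  have \<xi>sum: "(\<Oplus>\<^bsub>H\<^esub>u\<in>e. \<xi> (w @ [u])) = \<xi> w" if e: "e \<in> E" and w: "w \<in> lists V" for e w
  proof (rule eq_if_total)
    have mem: "(\<lambda>u. \<xi> (w @ [u])) \<in> e \<rightarrow> carrier H"
      using V(2)[OF e] w by (auto intro!: \<xi>)
    show "(\<Oplus>\<^bsub>H\<^esub>u\<in>e. \<xi> (w @ [u])) \<in> carrier H" by (rule M.finsum_closed[OF mem])
    show "\<xi> w \<in> carrier H" by (rule \<xi>[OF w])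
    fix w' assume w': "w' \<in> lists V"
    have "ip H (\<xi> w') (\<Oplus>\<^bsub>H\<^esub>u\<in>e. \<xi> (w @ [u])) = (\<Sum>u\<in>e. ip H (\<xi> w') (\<xi> (w @ [u])))"
      by (rule ip_finsum_right[OF fin[OF e] \<xi>[OF w'] mem])
    also have "\<dots> = (\<Sum>u\<in>e. cnj (M (w @ [u]) w'))"
    proof (rule sum.cong[OF refl])
      fix u assume "u \<in> e"
      then have wu: "w @ [u] \<in> lists V" using V(2)[OF e] w by auto
      show "ip H (\<xi> w') (\<xi> (w @ [u])) = cnj (M (w @ [u]) w')"
        using ip_cnj[OF \<xi>[OF wu] \<xi>[OF w']] ip_\<xi>[OF wu w'] by simp
    qed
    also have "\<dots> = cnj (ip H (\<xi> w) (\<xi> w'))"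
      using Msum[OF e w w'] ip_\<xi>[OF w w'] by (simp flip: cnj_sum)
    also have "\<dots> = ip H (\<xi> w') (\<xi> w)"
      by (rule ip_cnj[OF \<xi>[OF w] \<xi>[OF w'], symmetric])
    finally show "ip H (\<xi> w') (\<Oplus>\<^bsub>H\<^esub>u\<in>e. \<xi> (w @ [u])) = ip H (\<xi> w') (\<xi> w)" .
  qed
  \<comment> \<open>The closed span of \<open>T v\<close> is to be the range of \<open>P v\<close>.
    By the zero rule, \<open>T u\<close> and \<open>T v\<close> are orthogonal whenever
    \<open>u\<close> and \<open>v\<close> are.\<close>
  define T where "T v = (\<lambda>w. \<xi> (w @ [v])) ` lists V" for v
  have "\<forall>v\<in>V. \<exists>P. orthogonal_projection H P \<and> (\<forall>t\<in>T v. P t = t) \<and>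
    (\<forall>x\<in>carrier H. (\<forall>t\<in>T v. ip H t x = 0) \<longrightarrow> P x = \<zero>\<^bsub>H\<^esub>)"
    by (intro ballI projection_onto_span) (auto simp: T_def intro!: \<xi>)
  from bchoice[OF this] obtain P where P: "\<forall>v\<in>V. orthogonal_projection H (P v) \<and>
    (\<forall>t\<in>T v. P v t = t) \<and> (\<forall>x\<in>carrier H. (\<forall>t\<in>T v. ip H t x = 0) \<longrightarrow> P v x = \<zero>\<^bsub>H\<^esub>)" ..
  have proj: "orthogonal_projection H (P v)" if "v \<in> V" for v
    using P that by blast
  have P_same: "P v (\<xi> (w @ [v])) = \<xi> (w @ [v])" if "v \<in> V" "w \<in> lists V" for v w
    using P that by (simp add: T_def)
  have P_orth: "P v (\<xi> (w @ [u])) = \<zero>\<^bsub>H\<^esub>"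
    if "v \<in> V" "u \<in> V" "w \<in> lists V" "orth E v u" for v u w
  proof -
    have "ip H t (\<xi> (w @ [u])) = 0" if t: "t \<in> T v" for t
    proof -
      obtain w' where "w' \<in> lists V" "t = \<xi> (w' @ [v])"
        using t unfolding T_def by blast
      then show ?thesis
        using Morth ip_\<xi>[OF snoc snoc] \<open>v \<in> V\<close> \<open>u \<in> V\<close> \<open>w \<in> lists V\<close> \<open>orth E v u\<close> by simp
    qed
    then show ?thesis using P \<xi>[OF snoc] that by blast
  qed
  \<comment> \<open>Expand \<open>\<xi> w\<close> along an edge containing \<open>v\<close>, which
    exists because the edges cover \<open>V\<close>: \<open>P v\<close> fixes the term
    \<open>u = v\<close> and annihilates the others.\<close>
  have P\<xi>: "P v (\<xi> w) = \<xi> (w @ [v])" if v: "v \<in> V" and w: "w \<in> lists V" for v w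
  proof (rule eq_if_ip_eq)
    show "P v (\<xi> w) \<in> carrier H" by (rule projection_closed[OF proj[OF v] \<xi>[OF w]])
    show "\<xi> (w @ [v]) \<in> carrier H" by (rule \<xi>[OF snoc[OF w v]])
    fix z assume z: "z \<in> carrier H"
    obtain e where e: "e \<in> E" "v \<in> e" using v V(3) by blast
    have mem: "(\<lambda>u. \<xi> (w @ [u])) \<in> e \<rightarrow> carrier H"
      using V(2)[OF e(1)] w by (auto intro!: \<xi>)
    then have mem': "(\<lambda>u. P v (\<xi> (w @ [u]))) \<in> e \<rightarrow> carrier H"
      using projection_closed[OF proj[OF v]] by blast
    have "ip H z (P v (\<xi> w)) = ip H z (P v (\<Oplus>\<^bsub>H\<^esub>u\<in>e. \<xi> (w @ [u])))"
      by (simp only: \<xi>sum[OF e(1) w])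
    also have "\<dots> = (\<Sum>u\<in>e. ip H z (P v (\<xi> (w @ [u]))))"
      by (simp add: bounded_operator_finsum[OF projection_bounded[OF proj[OF v]] fin[OF e(1)] mem]
          ip_finsum_right[OF fin[OF e(1)] z mem'])
    also have "\<dots> = (\<Sum>u\<in>e. if u = v then ip H z (\<xi> (w @ [v])) else 0)"
    proof (rule sum.cong[OF refl])
      fix u assume u: "u \<in> e"
      then have uV: "u \<in> V" using V(2)[OF e(1)] by blast
      show "ip H z (P v (\<xi> (w @ [u]))) = (if u = v then ip H z (\<xi> (w @ [v])) else 0)"
      proof (cases "u = v")
        case False
        then have "orth E v u" using e u unfolding orth_def by blast
        then show ?thesis using P_orth[OF v uV w] z False by simp
      qed (simp add: P_same[OF v w])
    qed
    also have "\<dots> = ip H z (\<xi> (w @ [v]))"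
      using fin[OF e(1)] e(2) by simp
    finally show "ip H z (P v (\<xi> w)) = ip H z (\<xi> (w @ [v]))" .
  qed
  \<comment> \<open>Moving \<open>P v\<close> to the left argument replaces \<open>\<xi> w\<close>
    by \<open>\<xi> (w @ [v])\<close>, and these vectors sum to \<open>\<xi> w\<close>.\<close>
  have resolution: "(\<Oplus>\<^bsub>H\<^esub>v\<in>e. P v x) = x" if e: "e \<in> E" and x: "x \<in> carrier H" for e x
  proof (rule eq_if_total)
    have mem: "(\<lambda>v. P v x) \<in> e \<rightarrow> carrier H"
      using V(2)[OF e] projection_closed[OF proj _] x by blast
    show "(\<Oplus>\<^bsub>H\<^esub>v\<in>e. P v x) \<in> carrier H" by (rule M.finsum_closed[OF mem])
    show "x \<in> carrier H" by (rule x)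
    fix w assume w: "w \<in> lists V"
    have memw: "(\<lambda>v. \<xi> (w @ [v])) \<in> e \<rightarrow> carrier H"
      using V(2)[OF e] w by (auto intro!: \<xi>)
    have "ip H (\<xi> w) (\<Oplus>\<^bsub>H\<^esub>v\<in>e. P v x) = (\<Sum>v\<in>e. ip H (\<xi> w) (P v x))"
      by (rule ip_finsum_right[OF fin[OF e] \<xi>[OF w] mem])
    also have "\<dots> = (\<Sum>v\<in>e. ip H (\<xi> (w @ [v])) x)"
    proof (rule sum.cong[OF refl])
      fix v assume "v \<in> e"
      then have v: "v \<in> V" using V(2)[OF e] by blast
      show "ip H (\<xi> w) (P v x) = ip H (\<xi> (w @ [v])) x"
        using projection_self_adjoint[OF proj[OF v] \<xi>[OF w] x] P\<xi>[OF v w] by simp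
    qed
    also have "\<dots> = ip H (\<Oplus>\<^bsub>H\<^esub>v\<in>e. \<xi> (w @ [v])) x"
      by (rule ip_finsum_left[OF fin[OF e] x memw, symmetric])
    finally show "ip H (\<xi> w) (\<Oplus>\<^bsub>H\<^esub>v\<in>e. P v x) = ip H (\<xi> w) x"
      by (simp only: \<xi>sum[OF e w])
  qed
  have \<psi>: "\<xi> [] \<in> carrier H" "ip H (\<xi> []) (\<xi> []) = 1"
    using \<xi>[of "[]"] ip_\<xi>[of "[]" "[]"] M1 by simp_all
  have "complex_of_real (p v) = op_trace H (rank_one (\<xi> []) \<circ> P v)" if v: "v \<in> V" for v
    using op_trace_rank_one_projection[OF \<psi> proj[OF v]] P\<xi>[OF v, of "[]"] ip_\<xi>[of "[v]" "[]"] pM[OF v] v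
    by simp
  then show ?thesis
    unfolding quantum_models_def
    using p complex_hilbert_space_axioms density_operator_rank_one[OF \<psi>] proj resolution by blast
qed

section \<open>Uniform bounds and the limit of the certificates\<close>

lemma finite_strings: "finite V \<Longrightarrow> finite (strings V n)"
proof -
  assume "finite V"
  moreover have "strings V n = {xs. set xs \<subseteq> V \<and> length xs \<le> n}"
    by (auto simp: strings_def lists_eq_set)
  ultimately show ?thesis using finite_lists_length_le by simp
qed

text \<open>Within an edge the zero rule leaves one term of the sum rule, so
  \<open>M (u @ [a]) u\<close> is a diagonal entry. Summing over the edge writes
  \<open>M u u\<close> as a sum of nonnegative diagonal entries: appending a letter cannot increase
  the diagonal. From \<open>M [] [] = 1\<close> it stays at most 1, and Cauchy-Schwarz extends the
  bound.\<close>

lemma quantum_level_entry_bound: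
  assumes H: "contextuality_scenario V E" and psd: "psd_matrix_on (strings V n) M" and M1: "M [] [] = 1"
    and Msum: "\<forall>e\<in>E. \<forall>v\<in>strings V (n - 1). \<forall>w\<in>strings V n. (\<Sum>x\<in>e. M (v @ [x]) w) = M v w"
    and Morth: "\<forall>v\<in>strings V n. \<forall>w\<in>strings V n.
          v \<noteq> [] \<and> w \<noteq> [] \<and> orth E (last v) (last w) \<longrightarrow> M v w = 0"
    and v: "v \<in> strings V n" and w: "w \<in> strings V n"
  shows "cmod (M v w) \<le> 1"
proof -
  have V: "finite V" "\<And>e. e \<in> E \<Longrightarrow> e \<subseteq> V" "\<Union>E = V"
    using H unfolding contextuality_scenario_def by auto
  have psd': "psd_kernel (strings V n) M" by (rule psd_kernel_finite[OF finite_strings[OF V(1)] psd])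
  have diag: "Re (M u u) \<le> 1" if "u \<in> strings V n" for u
    using that
  proof (induction u rule: rev_induct)
    case (snoc x u)
    then have u: "u \<in> strings V n" "u \<in> strings V (n - 1)" and x: "x \<in> V"
      and snoc_mem: "\<And>y. y \<in> V \<Longrightarrow> u @ [y] \<in> strings V n"
      by (auto simp: strings_def)
    obtain e where e: "e \<in> E" "x \<in> e" using x V(3) by blast
    then have eV: "e \<subseteq> V" using V(2) by blast
    then have "finite e" using V(1) by (rule finite_subset)
    have eq: "M (u @ [a]) u = M (u @ [a]) (u @ [a])" if a: "a \<in> e" for a
    proof -
      have mem: "u @ [b] \<in> strings V n" if "b \<in> e" for b using snoc_mem eV that by blast
      have "M u (u @ [a]) = (\<Sum>b\<in>e. M (u @ [b]) (u @ [a]))"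
        using Msum e(1) u(2) mem[OF a] by simp
      also have "\<dots> = (\<Sum>b\<in>e. if b = a then M (u @ [a]) (u @ [a]) else 0)"
      proof (rule sum.cong[OF refl])
        fix b assume b: "b \<in> e"
        have "M (u @ [b]) (u @ [a]) = 0" if "b \<noteq> a"
        proof -
          have "orth E b a" using that a b e(1) unfolding orth_def by blast
          then show ?thesis using Morth mem[OF a] mem[OF b] by simp
        qed
        then show "M (u @ [b]) (u @ [a]) = (if b = a then M (u @ [a]) (u @ [a]) else 0)" by auto
      qed
      also have "\<dots> = M (u @ [a]) (u @ [a])" using \<open>finite e\<close> a by simp
      finally show ?thesis
        using psd_kernel_hermitian[OF psd' u(1) mem[OF a]] psd_kernel_hermitian[OF psd' mem[OF a] mem[OF a]]
        by simp
    qed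
    have "M u u = (\<Sum>a\<in>e. M (u @ [a]) u)"
      using Msum e(1) u by simp
    then have "M u u = (\<Sum>a\<in>e. M (u @ [a]) (u @ [a]))"
      using eq by simp
    then have "Re (M u u) = (\<Sum>a\<in>e. Re (M (u @ [a]) (u @ [a])))" by simp
    moreover have "Re (M (u @ [x]) (u @ [x])) \<le> (\<Sum>a\<in>e. Re (M (u @ [a]) (u @ [a])))"
    proof (rule member_le_sum[OF e(2) _ \<open>finite e\<close>])
      fix a assume "a \<in> e - {x}"
      then have "u @ [a] \<in> strings V n" using snoc_mem eV by blast
      then show "0 \<le> Re (M (u @ [a]) (u @ [a]))"
        using psd_kernel_diag[OF psd'] by (simp add: complex_nonneg_Reals_iff)
    qed
    ultimately show ?case using snoc.IH[OF u(1)] by linarith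
  qed (simp add: M1)
  have "(cmod (M v w))\<^sup>2 \<le> Re (M v v) * Re (M w w)"
    by (rule psd_kernel_Cauchy_Schwarz[OF psd' v w])
  also have "\<dots> \<le> 1 * 1"
    using diag[OF v] diag[OF w] psd_kernel_diag[OF psd' v] psd_kernel_diag[OF psd' w]
    by (intro mult_mono) (auto simp: complex_nonneg_Reals_iff)
  finally have "(cmod (M v w))\<^sup>2 \<le> 1\<^sup>2" by simp
  then show ?thesis by (rule power2_le_imp_le) simp
qed

lemma moment_matrix_of_levels:
  assumes H: "contextuality_scenario V E" and p: "\<And>n. n \<ge> 1 \<Longrightarrow> p \<in> quantum_level n V E"
  shows "\<exists>M. moment_matrix V E M \<and> (\<forall>v\<in>V. complex_of_real (p v) = M [v] [])"
proof -
  have V: "finite V" "\<And>e. e \<in> E \<Longrightarrow> e \<subseteq> V"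
    using H unfolding contextuality_scenario_def by auto
  let ?level = "\<lambda>n M. psd_matrix_on (strings V n) M \<and> M [] [] = 1 \<and>
       (\<forall>e\<in>E. \<forall>v\<in>strings V (n - 1). \<forall>w\<in>strings V n. (\<Sum>x\<in>e. M (v @ [x]) w) = M v w) \<and>
       (\<forall>v\<in>strings V n. \<forall>w\<in>strings V n.
          v \<noteq> [] \<and> w \<noteq> [] \<and> orth E (last v) (last w) \<longrightarrow> M v w = 0) \<and>
       (\<forall>v\<in>V. complex_of_real (p v) = M [v] [])"
  have "\<forall>n. \<exists>M. ?level (Suc n) M"
    using p[of "Suc n" for n] unfolding quantum_level_def by simp
  from choice[OF this] obtain M where M: "\<forall>n. ?level (Suc n) (M n)" ..
  \<comment> \<open>Padding by zero gives functions on all pairs of strings with the common bound 1,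
    as needed to extract a subsequence that converges at every point of a countable set.\<close>
  define f where "f = (\<lambda>n (v, w). if v \<in> strings V (Suc n) \<and> w \<in> strings V (Suc n) then M n v w else 0)"
  have f: "f n (v, w) = M n v w" if "v \<in> strings V (Suc n)" "w \<in> strings V (Suc n)" for n v w
    using that by (simp add: f_def)
  have "countable (lists V \<times> lists V)"
    using V(1) by (intro countable_SIGMA countable_lists countable_finite)
  moreover have "norm (f n vw) \<le> 1" for n vw
  proof (cases vw)
    case (Pair v w)
    show ?thesis
      using quantum_level_entry_bound[OF H, of "Suc n" "M n" v w] M[rule_format, of n]
      unfolding Pair f_def by auto
  qed
  ultimately obtain k where k: "strict_mono k"
    and "\<And>vw. vw \<in> lists V \<times> lists V \<Longrightarrow> \<exists>l. (\<lambda>n. f (k n) vw) \<longlonglongrightarrow> l"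
    using function_convergent_subsequence[of "lists V \<times> lists V" f 1] by metis
  then have "\<forall>vw\<in>lists V \<times> lists V. \<exists>l. (\<lambda>n. f (k n) vw) \<longlonglongrightarrow> l" by blast
  from bchoice[OF this] obtain N' where
    N': "\<forall>vw\<in>lists V \<times> lists V. (\<lambda>n. f (k n) vw) \<longlonglongrightarrow> N' vw" ..
  define N where "N v w = N' (v, w)" for v w
  have lim: "(\<lambda>n. f (k n) (v, w)) \<longlonglongrightarrow> N v w" if "v \<in> lists V" "w \<in> lists V" for v w
    using N' that by (simp add: N_def)
  \<comment> \<open>Strict monotonicity gives \<open>k n \<ge> n\<close>. The matrix
    \<open>M (k n)\<close> has level \<open>Suc (k n)\<close>, so strings of length at most
    \<open>k n\<close> leave room for the letter appended in the sum rule.\<close>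
  have ev: "eventually (\<lambda>n. v \<in> strings V (k n)) sequentially" if v: "v \<in> lists V" for v
    using eventually_ge_at_top[of "length v"]
  proof eventually_elim
    case (elim n)
    then show ?case using v seq_suble[OF k, of n] by (simp add: strings_def)
  qed
  have mono: "v \<in> strings V (Suc n)" if "v \<in> strings V n" for v n
    using that by (simp add: strings_def)
  \<comment> \<open>All equations for the limit matrix come from here: what eventually holds along
    the subsequence passes to \<open>N\<close>. Positivity instead uses closedness of the
    nonnegative reals.\<close>
  have unique: "N v w = l" if "v \<in> lists V" "w \<in> lists V"
    "eventually (\<lambda>n. f (k n) (v, w) = g n) sequentially" "g \<longlonglongrightarrow> l" for v w g l
    using LIMSEQ_unique[OF Lim_transform_eventually[OF lim[OF that(1,2)] that(3)] that(4)] .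
  have "psd_kernel (lists V) N"
    unfolding psd_kernel_def psd_matrix_on_def
  proof (intro allI impI)
    fix F and c :: "'a list \<Rightarrow> complex"
    assume F: "finite F \<and> F \<subseteq> lists V"
    have "eventually (\<lambda>n. \<forall>v\<in>F. v \<in> strings V (k n)) sequentially"
      using F ev by (intro eventually_ball_finite) auto
    then have "eventually (\<lambda>n. (\<Sum>i\<in>F. \<Sum>j\<in>F. cnj (c i) * f (k n) (i, j) * c j) \<in> \<real>\<^sub>\<ge>\<^sub>0) sequentially"
    proof eventually_elim
      case (elim n)
      then have FS: "F \<subseteq> strings V (Suc (k n))" using mono by blast
      have "(\<Sum>i\<in>F. \<Sum>j\<in>F. cnj (c i) * f (k n) (i, j) * c j) =
          (\<Sum>i\<in>F. \<Sum>j\<in>F. cnj (c i) * M (k n) i j * c j)"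
        using FS by (intro sum.cong refl) (simp add: f subset_iff)
      moreover have "psd_kernel (strings V (Suc (k n))) (M (k n))"
        using psd_kernel_finite[OF finite_strings[OF V(1)]] M by blast
      ultimately show ?case using psd_kernelD[of _ "M (k n)" F c] F FS by simp
    qed
    moreover have "(\<lambda>n. \<Sum>i\<in>F. \<Sum>j\<in>F. cnj (c i) * f (k n) (i, j) * c j) \<longlonglongrightarrow>
        (\<Sum>i\<in>F. \<Sum>j\<in>F. cnj (c i) * N i j * c j)"
      using F by (intro tendsto_intros lim) auto
    ultimately show "(\<Sum>i\<in>F. \<Sum>j\<in>F. cnj (c i) * N i j * c j) \<in> \<real>\<^sub>\<ge>\<^sub>0"
      by (intro Lim_in_closed_set[OF closed_nonneg_Reals_complex]) auto
  qed
  moreover have "N [] [] = 1"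
  proof (rule unique)
    show "eventually (\<lambda>n. f (k n) ([], []) = 1) sequentially"
      using M by (simp add: f strings_def)
  qed auto
  moreover have "(\<Sum>x\<in>e. N (v @ [x]) w) = N v w"
    if e: "e \<in> E" and v: "v \<in> lists V" and w: "w \<in> lists V" for e v w
  proof -
    have "N v w = (\<Sum>x\<in>e. N (v @ [x]) w)"
    proof (rule unique[OF v w])
      show "eventually (\<lambda>n. f (k n) (v, w) = (\<Sum>x\<in>e. f (k n) (v @ [x], w))) sequentially"
        using ev[OF v] ev[OF w]
      proof eventually_elim
        case (elim n)
        have "v @ [x] \<in> strings V (Suc (k n))" if "x \<in> e" for x
          using that V(2)[OF e] elim(1) by (auto simp: strings_def)
        then have "(\<Sum>x\<in>e. f (k n) (v @ [x], w)) = (\<Sum>x\<in>e. M (k n) (v @ [x]) w)"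
          using mono[OF elim(2)] by (intro sum.cong refl f)
        also have "\<dots> = M (k n) v w"
          using M e elim(1) mono[OF elim(2)] by simp
        finally show ?case using f[OF mono[OF elim(1)] mono[OF elim(2)]] by simp
      qed
      show "(\<lambda>n. \<Sum>x\<in>e. f (k n) (v @ [x], w)) \<longlonglongrightarrow> (\<Sum>x\<in>e. N (v @ [x]) w)"
        using v w V(2)[OF e] by (intro tendsto_sum lim) auto
    qed
    then show ?thesis by simp
  qed
  moreover have "N v w = 0"
    if v: "v \<in> lists V" and w: "w \<in> lists V" and "v \<noteq> []" "w \<noteq> []" "orth E (last v) (last w)" for v w
  proof (rule unique[OF v w])
    show "eventually (\<lambda>n. f (k n) (v, w) = 0) sequentially"
      using ev[OF v] ev[OF w]
    proof eventually_elim
      case (elim n)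
      then show ?case using M mono f that by simp
    qed
  qed auto
  moreover have "complex_of_real (p v) = N [v] []" if v: "v \<in> V" for v
  proof (rule unique[symmetric])
    show "eventually (\<lambda>n. f (k n) ([v], []) = complex_of_real (p v)) sequentially"
      using M v by (simp add: f strings_def)
  qed (use v in auto)
  ultimately show ?thesis unfolding moment_matrix_def by blast
qed

section \<open>From a quantum model to the hierarchy\<close>

lemma has_sum_finite_sum:
  fixes f :: "'i \<Rightarrow> 'a \<Rightarrow> 'b::topological_comm_monoid_add"
  assumes "finite F" "\<And>i. i \<in> F \<Longrightarrow> (f i has_sum s i) A"
  shows "((\<lambda>x. \<Sum>i\<in>F. f i x) has_sum (\<Sum>i\<in>F. s i)) A"
  using assms by (induction F) (auto intro!: has_sum_add has_sum_0)

lemma has_sum_nonneg_Reals: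
  fixes s :: complex
  assumes "(f has_sum s) A" "\<And>x. x \<in> A \<Longrightarrow> f x \<in> \<real>\<^sub>\<ge>\<^sub>0"
  shows "s \<in> \<real>\<^sub>\<ge>\<^sub>0"
proof -
  have "0 \<le> Re s"
    by (rule has_sum_nonneg[OF has_sum_Re[OF assms(1)]]) (use assms(2) in \<open>simp add: complex_nonneg_Reals_iff\<close>)
  moreover have "((\<lambda>x. Im (f x)) has_sum 0) A"
    by (rule has_sum_0) (use assms(2) in \<open>simp add: complex_nonneg_Reals_iff\<close>)
  then have "Im s = 0"
    using has_sum_Im[OF assms(1)] has_sum_unique by blast
  ultimately show ?thesis by (simp add: complex_nonneg_Reals_iff)
qed

section \<open>Decomposition of a density operator\<close>

context complex_hilbert_space
begin

lemma basis_carrier: "orthonormal_basis H B \<Longrightarrow> b \<in> B \<Longrightarrow> b \<in> carrier H"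
  unfolding orthonormal_basis_def orthonormal_in_def by blast

lemma Parseval_norm:
  assumes B: "orthonormal_basis H B" and x: "x \<in> carrier H"
  shows "((\<lambda>b. (cmod (ip H b x))\<^sup>2) has_sum (ip_norm H x)\<^sup>2) B"
proof -
  have "ip H x b * ip H b x = of_real ((cmod (ip H b x))\<^sup>2)" if "b \<in> B" for b
    using ip_cnj[OF basis_carrier[OF B that] x] complex_norm_square[of "ip H b x"]
    by (simp add: mult.commute)
  then have "((\<lambda>b. complex_of_real ((cmod (ip H b x))\<^sup>2)) has_sum of_real ((ip_norm H x)\<^sup>2)) B"
    using Parseval[OF B x x] unfolding norm_square[OF x] by (simp only: cong: has_sum_cong)
  then show ?thesis unfolding has_sum_of_real_iff .
qed

lemma positive_operator_self_adjoint:
  assumes A: "positive_operator H A" and x: "x \<in> carrier H" and y: "y \<in> carrier H"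
  shows "ip H (A x) y = ip H x (A y)"
proof -
  have Ax: "A x \<in> carrier H"
    using A x bounded_operator_closed unfolding positive_operator_def by blast
  show ?thesis
    using psd_kernel_hermitian[OF psd_kernel_positive_operator[OF A] y x] ip_cnj[OF y Ax] by simp
qed

text \<open>The functionals of the Cholesky decomposition of \<open>\<langle>x, A y\<rangle>\<close> along \<open>e\<close> are given by vectors
  in the span of the \<open>A (e j)\<close>, so that no representation theorem is needed.\<close>

lemma cholesky_vector:
  assumes A: "positive_operator H A" and e: "\<And>n. e n \<in> carrier H"
  shows "\<exists>u\<in>carrier H. \<forall>y\<in>carrier H. cholesky (\<lambda>x y. ip H x (A y)) e k y = ip H u y"
proof (induction k rule: less_induct)
  case (less k)
  let ?a = "cholesky (\<lambda>x y. ip H x (A y)) e"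
  have "\<forall>j\<in>{..<k}. \<exists>u. u \<in> carrier H \<and> (\<forall>y\<in>carrier H. ?a j y = ip H u y)"
    using less by blast
  from bchoice[OF this] obtain u where
    u: "\<forall>j\<in>{..<k}. u j \<in> carrier H \<and> (\<forall>y\<in>carrier H. ?a j y = ip H (u j) y)" ..
  obtain s where s: "\<forall>y\<in>carrier H. ?a k y =
      s * (ip H (e k) (A y) - (\<Sum>j<k. cnj (?a j (e k)) * ?a j y))"
    using cholesky_recursion[where e = e and n = k, OF psd_kernel_positive_operator[OF A] e] by blast
  \<comment> \<open>The inner product is conjugate-linear on the left, so the coefficients stand
    here unconjugated and the scalar below becomes \<open>cnj s\<close>.\<close>
  define w where "w = (\<Oplus>j\<in>{..<k}. ?a j (e k) \<odot> u j)"
  have mem: "(\<lambda>j. ?a j (e k) \<odot> u j) \<in> {..<k} \<rightarrow> carrier H" using u by auto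
  have w: "w \<in> carrier H" unfolding w_def by (rule M.finsum_closed[OF mem])
  have Ae: "A (e k) \<in> carrier H"
    using A e bounded_operator_closed unfolding positive_operator_def by blast
  show ?case
  proof (intro bexI ballI)
    fix y assume y: "y \<in> carrier H"
    have "ip H w y = (\<Sum>j<k. cnj (?a j (e k)) * ?a j y)"
      unfolding w_def ip_finsum_left[OF finite_lessThan y mem]
      using u y by (intro sum.cong refl) (simp add: ip_smult_left)
    then show "?a k y = ip H (cnj s \<odot> (A (e k) \<ominus> w)) y"
      using s y w Ae positive_operator_self_adjoint[OF A e y]
      by (simp add: ip_smult_left ip_diff_left)
  qed (use Ae w in simp)
qed

text \<open>This replaces the square root of \<open>\<rho>\<close>: one has \<open>\<rho> = \<Sum>\<^sub>k |u\<^sub>k\<rangle>\<langle>u\<^sub>k|\<close>.\<close>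

lemma density_operator_decomposition:
  assumes \<rho>: "density_operator H \<rho>"
  shows "\<exists>u :: nat \<Rightarrow> 'a. (\<forall>k. u k \<in> carrier H) \<and>
    (\<forall>P. orthogonal_projection H P \<longrightarrow> ((\<lambda>k. ip H (P (u k)) (u k)) has_sum op_trace H (\<rho> \<circ> P)) UNIV)"
proof -
  define B where "B = (SOME B. orthonormal_basis H B)"
  have B: "orthonormal_basis H B" unfolding B_def by (rule some_orthonormal_basis)
  have pos: "positive_operator H \<rho>" and tr: "op_trace H \<rho> = 1"
    using \<rho> unfolding density_operator_def by auto
  define K where "K = (\<lambda>x y. ip H x (\<rho> y))"
  have psd: "psd_kernel (carrier H) K"
    unfolding K_def by (rule psd_kernel_positive_operator[OF pos])
  have infsum1: "(\<Sum>\<^sub>\<infinity>b\<in>B. K b b) = 1"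
    using tr unfolding op_trace_def K_def B_def .
  \<comment> \<open>A divergent \<open>infsum\<close> has the default value 0, so the value 1 forces
    summability.\<close>
  then have Ksum: "(\<lambda>b. K b b) summable_on B"
    using infsum_not_exists by fastforce
  \<comment> \<open>The basis may be uncountable, but a summable family has countable support; the
    basis vectors with nonzero diagonal entry can therefore be enumerated as pivots.\<close>
  define B1 where "B1 = {b \<in> B. K b b \<noteq> 0}"
  have B1: "B1 \<subseteq> carrier H" "countable B1" "B1 \<noteq> {}"
  proof -
    show "B1 \<subseteq> carrier H" using basis_carrier[OF B] by (auto simp: B1_def)
    show "countable B1" unfolding B1_def by (rule summable_countable_complex[OF Ksum])
    show "B1 \<noteq> {}"
    proof
      assume "B1 = {}"
      then have "(\<Sum>\<^sub>\<infinity>b\<in>B. K b b) = 0" by (intro infsum_0) (auto simp: B1_def)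
      then show False using infsum1 by simp
    qed
  qed
  define e where "e = from_nat_into B1"
  have e: "e n \<in> carrier H" for n
    using from_nat_into[OF B1(3)] B1(1) unfolding e_def by blast
  have range_e: "range e = B1" unfolding e_def by (rule range_from_nat_into[OF B1(3,2)])
  have "\<forall>k. \<exists>u. u \<in> carrier H \<and> (\<forall>y\<in>carrier H. cholesky K e k y = ip H u y)"
    using cholesky_vector[where e = e, OF pos e] unfolding K_def by blast
  from choice[OF this] obtain u where
    u_all: "\<forall>k. u k \<in> carrier H \<and> (\<forall>y\<in>carrier H. cholesky K e k y = ip H (u k) y)" ..
  then have u: "u k \<in> carrier H" for k by blast
  have ip_u: "ip H (u k) y = cholesky K e k y" if "y \<in> carrier H" for k y
    using u_all that by simp
  have column: "((\<lambda>k. ip H b (u k) * ip H (u k) y) has_sum K b y) UNIV"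
    if b: "b \<in> B" and y: "y \<in> carrier H" for b y
  proof -
    have bc: "b \<in> carrier H" by (rule basis_carrier[OF B b])
    have eq: "ip H b (u k) * ip H (u k) y = cnj (cholesky K e k b) * cholesky K e k y" for k
      using ip_cnj[OF u bc] ip_u[OF bc] ip_u[OF y] by simp
    show ?thesis
    proof (cases "K b b = 0")
      case True
      \<comment> \<open>Basis vectors outside the sequence contribute nothing: both sides vanish
        together with the diagonal entry.\<close>
      have "cholesky K e k b = 0" for k by (rule cholesky_null[where e = e, OF psd e bc True])
      moreover have "K b y = 0" by (rule psd_kernel_null(1)[OF psd bc y True])
      ultimately show ?thesis unfolding eq by simp
    next
      case False
      then obtain j where j: "b = e j" using b range_e by (auto simp: B1_def)
      show ?thesis
        unfolding eq
      proof (rule has_sum_finite_neutralI[of "{..<Suc j}"])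
        show "cnj (cholesky K e k b) * cholesky K e k y = 0" if "k \<in> UNIV - {..<Suc j}" for k
        proof -
          have "cholesky K e k b = 0"
            unfolding j by (rule cholesky_triangular[where e = e, OF psd e]) (use that in simp)
          then show ?thesis by simp
        qed
        show "K b y = (\<Sum>k<Suc j. cnj (cholesky K e k b) * cholesky K e k y)"
          unfolding j by (rule cholesky_decomposition[where e = e, OF psd e _ y]) simp
      qed auto
    qed
  qed
  have norms: "((\<lambda>k. (cmod (ip H b (u k)))\<^sup>2) has_sum Re (K b b)) UNIV" if b: "b \<in> B" for b
  proof -
    have bc: "b \<in> carrier H" by (rule basis_carrier[OF B b])
    have "ip H b (u k) * ip H (u k) b = of_real ((cmod (ip H b (u k)))\<^sup>2)" for k
      using ip_cnj[OF bc u] complex_norm_square[of "ip H b (u k)"] by simp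
    then have "Re (ip H b (u k) * ip H (u k) b) = (cmod (ip H b (u k)))\<^sup>2" for k
      by (simp only: Re_complex_of_real)
    then show ?thesis using has_sum_Re[OF column[OF b bc]] by simp
  qed
  define q where "q = (\<lambda>(k, b). (cmod (ip H b (u k)))\<^sup>2)"
  \<comment> \<open>Summing over \<open>k\<close> first gives the diagonal of \<open>K\<close>,
    which is summable. In the other order Parseval gives the squared norms of the
    \<open>u k\<close>, which are therefore summable too.\<close>
  have "(\<lambda>(b, k). q (k, b)) summable_on B \<times> UNIV"
  proof (rule summable_on_SigmaI[where g = "\<lambda>b. Re (K b b)"])
    show "(\<lambda>b. Re (K b b)) summable_on B"
      using Ksum has_sum_Re unfolding summable_on_def by blast
  qed (simp_all add: q_def norms)
  then have q: "q summable_on UNIV \<times> B"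
    by (subst summable_on_swap) simp
  have q_row: "((\<lambda>b. q (k, b)) has_sum (ip_norm H (u k))\<^sup>2) B" for k
    unfolding q_def using Parseval_norm[OF B u] by simp
  then have "(\<lambda>k. \<Sum>\<^sub>\<infinity>b\<in>B. q (k, b)) summable_on UNIV"
    by (intro summable_on_SigmaD[OF q]) (auto simp: summable_on_def)
  then have u_norms: "(\<lambda>k. (ip_norm H (u k))\<^sup>2) summable_on UNIV"
    by (simp add: infsumI[OF q_row])
  have "((\<lambda>k. ip H (P (u k)) (u k)) has_sum op_trace H (\<rho> \<circ> P)) UNIV"
    if P: "orthogonal_projection H P" for P
  proof -
    note Pu = projection_closed[OF P u]
    have Pu_norms: "(\<lambda>k. (ip_norm H (P (u k)))\<^sup>2) summable_on UNIV"
    proof (rule summable_on_comparison_test[OF u_norms])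
      show "(ip_norm H (P (u k)))\<^sup>2 \<le> (ip_norm H (u k))\<^sup>2" for k
        by (intro power_mono projection_contraction[OF P u] ip_norm_nonneg[OF Pu])
    qed simp
    define r where "r = (\<lambda>(k, b). (cmod (ip H b (P (u k))))\<^sup>2)"
    have r: "r summable_on UNIV \<times> B"
      by (rule summable_on_SigmaI[OF _ Pu_norms]) (simp_all add: r_def Parseval_norm[OF B Pu])
    \<comment> \<open>Over \<open>b\<close>, Parseval sums this to
      \<open>ip H (P (u k)) (u k)\<close>; over \<open>k\<close>, the column identity sums it to
      \<open>K b (P b)\<close>, whose total is the trace. Domination by \<open>q + r\<close>
      justifies the exchange.\<close>
    define F where "F = (\<lambda>(k, b). ip H (P (u k)) b * ip H b (u k))"
    have "(\<lambda>x. norm (F x)) summable_on UNIV \<times> B"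
    proof (rule summable_on_comparison_test[OF summable_on_add[OF q r]])
      fix kb :: "nat \<times> 'a" assume "kb \<in> UNIV \<times> B"
      then obtain k b where kb: "kb = (k, b)" and b: "b \<in> B" by (cases kb) auto
      let ?x = "cmod (ip H b (P (u k)))" and ?y = "cmod (ip H b (u k))"
      have "norm (F kb) = ?x * ?y"
        using ip_cnj[OF basis_carrier[OF B b] Pu] by (simp add: F_def kb norm_mult)
      also have "\<dots> \<le> ?y\<^sup>2 + ?x\<^sup>2"
        proof -
          have "0 \<le> ?x * ?y" by simp
          then show ?thesis using sum_squares_bound[of ?x ?y] by linarith
        qed
      finally show "norm (F kb) \<le> q kb + r kb" by (simp add: q_def r_def kb)
    qed simp
    then have "F summable_on UNIV \<times> B" by (rule abs_summable_summable)
    then obtain S where S: "(F has_sum S) (UNIV \<times> B)" unfolding summable_on_def by blast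
    have rows: "((\<lambda>k. ip H (P (u k)) (u k)) has_sum S) UNIV"
      by (rule has_sum_SigmaD[OF S]) (simp add: F_def Parseval[OF B Pu u])
    have "((\<lambda>(b, k). F (k, b)) has_sum S) (B \<times> UNIV)"
      using S by (subst (asm) has_sum_swap)
    then have "((\<lambda>b. K b (P b)) has_sum S) B"
    proof (rule has_sum_SigmaD)
      fix b assume b: "b \<in> B"
      have bc: "b \<in> carrier H" by (rule basis_carrier[OF B b])
      have "F (k, b) = ip H b (u k) * ip H (u k) (P b)" for k
        using projection_self_adjoint[OF P u bc] by (simp add: F_def)
      then show "((\<lambda>k. case (b, k) of (b, k) \<Rightarrow> F (k, b)) has_sum K b (P b)) UNIV"
        using column[OF b projection_closed[OF P bc]] by simp
    qed
    then have "op_trace H (\<rho> \<circ> P) = S"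
      unfolding op_trace_def B_def[symmetric] using infsumI by (simp add: K_def)
    then show ?thesis using rows by simp
  qed
  then show ?thesis using u by blast
qed

end

section \<open>The certificate of a quantum model\<close>

lemma quantum_models_subset_level:
  fixes V :: "'v set"
  assumes "contextuality_scenario V E"
  shows "quantum_models TYPE('h) V E \<subseteq> quantum_level n V E"
proof
  fix p assume "p \<in> quantum_models TYPE('h) V E"
  then obtain H :: "'h inner_space" and \<rho> P where p: "p \<in> V \<rightarrow>\<^sub>E {0..1}"
    and hilbert: "complex_hilbert_space H" and \<rho>: "density_operator H \<rho>"
    and proj: "\<And>v. v \<in> V \<Longrightarrow> orthogonal_projection H (P v)"
    and resolution: "\<And>e x. e \<in> E \<Longrightarrow> x \<in> carrier H \<Longrightarrow> (\<Oplus>\<^bsub>H\<^esub>v\<in>e. P v x) = x"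
    and p_tr: "\<And>v. v \<in> V \<Longrightarrow> complex_of_real (p v) = op_trace H (\<rho> \<circ> P v)"
    unfolding quantum_models_def by blast
  interpret complex_hilbert_space H by (rule hilbert)
  have V: "finite V" "\<And>e. e \<in> E \<Longrightarrow> e \<subseteq> V"
    using assms(1) unfolding contextuality_scenario_def by auto
  have fin: "finite e" if "e \<in> E" for e
    using finite_subset[OF V(2)[OF that] V(1)] .
  obtain u :: "nat \<Rightarrow> 'h" where u: "\<And>k. u k \<in> carrier H"
    and u_tr: "\<And>Q. orthogonal_projection H Q \<Longrightarrow>
      ((\<lambda>k. ip H (Q (u k)) (u k)) has_sum op_trace H (\<rho> \<circ> Q)) UNIV"
    using density_operator_decomposition[OF \<rho>] by blast
  have u_unit: "((\<lambda>k. ip H (u k) (u k)) has_sum 1) UNIV"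
    using u_tr[OF orthogonal_projection_id] \<rho> by (simp add: density_operator_def comp_def)
  have mem: "(\<lambda>v. P v x) \<in> e \<rightarrow> carrier H" if "e \<in> E" "x \<in> carrier H" for e x
    using V(2)[OF that(1)] projection_closed[OF proj that(2)] by blast
  \<comment> \<open>\<open>fold\<close> applies the first letter first, so an appended letter acts
    outermost and the sum rule becomes the resolution of the identity at
    \<open>W v x\<close>.\<close>
  define W where "W v x = fold P v x" for v x
  have W_simps: "W [] x = x" "W (v @ [a]) x = P a (W v x)" for v a x
    by (simp_all add: W_def)
  have W: "W v x \<in> carrier H" "ip_norm H (W v x) \<le> ip_norm H x"
    if "v \<in> lists V" "x \<in> carrier H" for v x
    using that(1)
  proof (induction v rule: rev_induct)
    case (snoc a v)
    {
      case 1
      then show ?case using snoc projection_closed[OF proj] by (simp add: W_simps)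
    next
      case 2
      then show ?case
        using snoc order_trans[OF projection_contraction[OF proj]] by (simp add: W_simps)
    }
  qed (simp_all add: W_simps that(2))
  define g where "g v w k = ip H (W v (u k)) (W w (u k))" for v w k
  define M where "M v w = (\<Sum>\<^sub>\<infinity>k. g v w k)" for v w
  \<comment> \<open>Projections are contractions, so the squared norms of the \<open>u k\<close>,
    which sum to 1, dominate the series.\<close>
  have M: "(g v w has_sum M v w) UNIV" if "v \<in> lists V" "w \<in> lists V" for v w
  proof -
    have "(\<lambda>k. norm (g v w k)) summable_on UNIV"
    proof (rule summable_on_comparison_test)
      show "(\<lambda>k. Re (ip H (u k) (u k))) summable_on UNIV"
        using has_sum_Re[OF u_unit] unfolding summable_on_def by blast
      fix k
      have "norm (g v w k) \<le> ip_norm H (W v (u k)) * ip_norm H (W w (u k))"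
        unfolding g_def by (rule Cauchy_Schwarz[OF W(1)[OF that(1) u] W(1)[OF that(2) u]])
      also have "\<dots> \<le> ip_norm H (u k) * ip_norm H (u k)"
        by (intro mult_mono W(2)[OF that(1) u] W(2)[OF that(2) u] ip_norm_nonneg u W(1)[OF that(2) u])
      finally show "norm (g v w k) \<le> Re (ip H (u k) (u k))"
        using ip_norm_squared[OF ip_nonneg[OF u]] by (simp add: power2_eq_square)
    qed simp
    then have "g v w summable_on UNIV" by (rule abs_summable_summable)
    then show ?thesis unfolding M_def by (rule has_sum_infsum)
  qed
  \<comment> \<open>For \<open>y = P b x\<close> the resolution of the identity writes the squared
    norm of \<open>y\<close> as the sum of those of all \<open>P v y\<close>. The term
    \<open>v = b\<close> already accounts for all of it.\<close>
  have P_orth: "P a (P b x) = \<zero>\<^bsub>H\<^esub>"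
    if ab: "orth E a b" and x: "x \<in> carrier H" for a b x
  proof -
    obtain e where e: "e \<in> E" "a \<in> e" "b \<in> e" and "a \<noteq> b" using ab unfolding orth_def by blast
    have eV: "v \<in> V" if "v \<in> e" for v using V(2)[OF e(1)] that by blast
    define y where "y = P b x"
    have y: "y \<in> carrier H" unfolding y_def by (rule projection_closed[OF proj[OF eV[OF e(3)]] x])
    have Py: "P v y \<in> carrier H" if "v \<in> e" for v
      by (rule projection_closed[OF proj[OF eV[OF that]] y])
    have Pby: "P b y = y"
      unfolding y_def by (rule projection_idem[OF proj[OF eV[OF e(3)]] x])
    have "ip H y y = ip H y (\<Oplus>\<^bsub>H\<^esub>v\<in>e. P v y)" by (simp only: resolution[OF e(1) y])
    also have "\<dots> = (\<Sum>v\<in>e. ip H y (P v y))"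
      by (rule ip_finsum_right[OF fin[OF e(1)] y mem[OF e(1) y]])
    also have "\<dots> = (\<Sum>v\<in>e. ip H (P v y) (P v y))"
    proof (rule sum.cong[OF refl])
      fix v assume v: "v \<in> e"
      show "ip H y (P v y) = ip H (P v y) (P v y)"
        using projection_self_adjoint[OF proj[OF eV[OF v]] y Py[OF v]]
          projection_idem[OF proj[OF eV[OF v]] y] by simp
    qed
    also have "\<dots> = ip H (P b y) (P b y) + (\<Sum>v\<in>e - {b}. ip H (P v y) (P v y))"
      by (rule sum.remove[OF fin[OF e(1)] e(3)])
    finally have "(\<Sum>v\<in>e - {b}. ip H (P v y) (P v y)) = 0"
      by (simp add: Pby)
    then have "(\<Sum>v\<in>e - {b}. (ip_norm H (P v y))\<^sup>2) = 0"
      using norm_square[OF Py] by (simp flip: of_real_sum of_real_power)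
    then have "(ip_norm H (P a y))\<^sup>2 = 0"
      using fin[OF e(1)] e(2) \<open>a \<noteq> b\<close> by (subst (asm) sum_nonneg_eq_0_iff) auto
    then show ?thesis
      using ip_definite[OF Py[OF e(2)]] norm_square[OF Py[OF e(2)]] by (simp add: y_def)
  qed
  have sub: "v \<in> lists V" if "v \<in> strings V m" for v m using that by (simp add: strings_def)
  have M_psd: "psd_matrix_on (strings V n) M"
    unfolding psd_matrix_on_def
  proof
    fix c :: "'v list \<Rightarrow> complex"
    let ?S = "strings V n"
    show "(\<Sum>i\<in>?S. \<Sum>j\<in>?S. cnj (c i) * M i j * c j) \<in> \<real>\<^sub>\<ge>\<^sub>0"
    proof (rule has_sum_nonneg_Reals)
      show "((\<lambda>k. \<Sum>i\<in>?S. \<Sum>j\<in>?S. cnj (c i) * g i j k * c j) has_sum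
          (\<Sum>i\<in>?S. \<Sum>j\<in>?S. cnj (c i) * M i j * c j)) UNIV"
        by (intro has_sum_finite_sum finite_strings V(1) has_sum_cmult_left has_sum_cmult_right M sub)
      show "(\<Sum>i\<in>?S. \<Sum>j\<in>?S. cnj (c i) * g i j k * c j) \<in> \<real>\<^sub>\<ge>\<^sub>0" for k
        unfolding g_def
        by (rule positive_operator_gram[OF positive_operator_id finite_strings[OF V(1)]])
           (rule W(1)[OF sub u])
    qed
  qed
  have M_unit: "M [] [] = 1"
  proof (rule has_sum_unique)
    show "(g [] [] has_sum M [] []) UNIV" by (rule M) simp_all
    have "g [] [] = (\<lambda>k. ip H (u k) (u k))" by (simp add: fun_eq_iff g_def W_simps)
    then show "(g [] [] has_sum 1) UNIV" using u_unit by simp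
  qed
  have M_sum: "(\<Sum>x\<in>e. M (v @ [x]) w) = M v w"
    if e: "e \<in> E" and v: "v \<in> lists V" and w: "w \<in> lists V" for e v w
  proof (rule has_sum_unique)
    show "((\<lambda>k. \<Sum>x\<in>e. g (v @ [x]) w k) has_sum (\<Sum>x\<in>e. M (v @ [x]) w)) UNIV"
      using V(2)[OF e] v by (intro has_sum_finite_sum fin[OF e] M w) auto
    have "(\<Sum>x\<in>e. g (v @ [x]) w k) = g v w k" for k
    proof -
      have "(\<Sum>x\<in>e. g (v @ [x]) w k) = ip H (\<Oplus>\<^bsub>H\<^esub>x\<in>e. P x (W v (u k))) (W w (u k))"
        unfolding g_def W_simps
        by (rule ip_finsum_left[OF fin[OF e] W(1)[OF w u] mem[OF e W(1)[OF v u]], symmetric])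
      then show ?thesis by (simp only: resolution[OF e W(1)[OF v u]] g_def)
    qed
    then show "((\<lambda>k. \<Sum>x\<in>e. g (v @ [x]) w k) has_sum M v w) UNIV"
      using M[OF v w] by simp
  qed
  have M_orth: "M v w = 0"
    if v: "v \<in> lists V" and w: "w \<in> lists V" and ne: "v \<noteq> []" "w \<noteq> []" "orth E (last v) (last w)" for v w
  proof -
    obtain v' a where v': "v = v' @ [a]" using ne(1) by (metis append_butlast_last_id)
    obtain w' b where w': "w = w' @ [b]" using ne(2) by (metis append_butlast_last_id)
    have ab: "a \<in> V" "b \<in> V" "v' \<in> lists V" "w' \<in> lists V" "orth E a b"
      using v w ne(3) by (auto simp: v' w')
    have "g v w k = 0" for k
    proof -
      note Wv = W(1)[OF ab(3) u] and Ww = W(1)[OF ab(4) u]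
      have "g v w k = ip H (W v' (u k)) (P a (P b (W w' (u k))))"
        unfolding g_def v' w' W_simps
        by (rule projection_self_adjoint[OF proj[OF ab(1)] Wv projection_closed[OF proj[OF ab(2)] Ww]])
      then show ?thesis using P_orth[OF ab(5) Ww] Wv by simp
    qed
    then show ?thesis by (simp add: M_def)
  qed
  have M_p: "complex_of_real (p v) = M [v] []" if v: "v \<in> V" for v
  proof (rule has_sum_unique)
    have "g [v] [] = (\<lambda>k. ip H (P v (u k)) (u k))" by (simp add: fun_eq_iff g_def W_def)
    then show "(g [v] [] has_sum complex_of_real (p v)) UNIV"
      using u_tr[OF proj[OF v]] p_tr[OF v] by simp
    show "(g [v] [] has_sum M [v] []) UNIV" by (rule M) (use v in simp_all)
  qed
  show "p \<in> quantum_level n V E"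
    unfolding quantum_level_def
    by (intro CollectI conjI exI[of _ M] ballI impI p M_psd M_unit M_sum M_orth M_p sub; (elim conjE)?; assumption)
qed

text \<open>The levels mention no Hilbert space, so a model over any universe \<open>'h\<close>
  passes through them to one on square-summable sequences. Hence restricting the equality to
  carriers in \<open>nat \<Rightarrow> complex\<close> loses no models.\<close>

theorem theorem6p2p2:
  fixes V :: "'v set" and E :: "'v set set"
  assumes "contextuality_scenario V E"
  shows "quantum_models TYPE(nat \<Rightarrow> complex) V E = (\<Inter>n\<in>{1..}. quantum_level n V E) \<and>
    quantum_models TYPE('h) V E \<subseteq> quantum_models TYPE(nat \<Rightarrow> complex) V E"
proof (intro conjI equalityI subsetI)
  fix p assume "p \<in> quantum_models TYPE(nat \<Rightarrow> complex) V E"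
  then show "p \<in> (\<Inter>n\<in>{1..}. quantum_level n V E)"
    using quantum_models_subset_level[OF assms] by blast
next
  have from_levels: "p \<in> quantum_models TYPE(nat \<Rightarrow> complex) V E"
    if p: "\<And>n. n \<ge> 1 \<Longrightarrow> p \<in> quantum_level n V E" for p
  proof -
    obtain M where "moment_matrix V E M" "\<forall>v\<in>V. complex_of_real (p v) = M [v] []"
      using moment_matrix_of_levels[OF assms p] by blast
    moreover have "p \<in> V \<rightarrow>\<^sub>E {0..1}"
      using p[of 1] by (simp add: quantum_level_def)
    ultimately show ?thesis
      using quantum_model_of_moment_matrix[OF assms] by blast
  qed
  fix p
  show "p \<in> quantum_models TYPE(nat \<Rightarrow> complex) V E"
    if "p \<in> (\<Inter>n\<in>{1..}. quantum_level n V E)"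
    by (rule from_levels) (use that in blast)
  show "p \<in> quantum_models TYPE(nat \<Rightarrow> complex) V E"
    if "p \<in> quantum_models TYPE('h) V E"
    by (rule from_levels) (use that quantum_models_subset_level[OF assms] in blast)
qed

end
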